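(* For elements $u<w$ of $W$ with $u\in c_1$ and $w\in c_0$, we have $\mu(u,w)=1$ if $l(w)-l(u)=1$, and $\mu(u,w)=0$ otherwise.
   Context: $W$ is the affine Weyl group of type $\widetilde A_2$: the Coxeter group on $S=\{r,s,t\}$ with $(rs)^3=(st)^3=(rt)^3=1$, with length function $l$ and Bruhat order $\le$. For $u<w$, $\mu(u,w)$ is the coefficient of $q^{(l(w)-l(u)-1)/2}$ in the Kazhdan–Lusztig polynomial $P_{u,w}$. Using Lusztig's $\mathbf a$-function, $W$ has three two-sided cells: $\{e\}$, $c_1=\{w:\mathbf a(w)=1\}$, which is the set of $w\neq e$ having a unique reduced expression, and $c_0=\{w:\mathbf a(w)=3\}=W\setminus(\{e\}\cup c_1)$. *)

theory Defs
  imports Complex_Main "HOL-Library.Poly_Mapping" "HOL-Library.Extended_Nat"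
    "HOL-Computational_Algebra.Polynomial"
begin

section \<open>The affine Weyl group of type $\widetilde A_2$\<close>

datatype gen = GR | GS | GT

inductive cox_eq :: "gen list \<Rightarrow> gen list \<Rightarrow> bool" where
  cox_refl: "cox_eq xs xs"
| cox_sym: "cox_eq xs ys \<Longrightarrow> cox_eq ys xs"
| cox_trans: "cox_eq xs ys \<Longrightarrow> cox_eq ys zs \<Longrightarrow> cox_eq xs zs"
| cox_square: "cox_eq (xs @ [a, a] @ ys) (xs @ ys)"
| cox_cube: "a \<noteq> b \<Longrightarrow> cox_eq (xs @ [a, b, a, b, a, b] @ ys) (xs @ ys)"

lemma cox_eq_equivp: "equivp cox_eq"
  by (rule equivpI)
    (auto intro!: reflpI sympI transpI intro: cox_refl cox_sym cox_trans)

quotient_type weyl = "gen list" / cox_eq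
  by (rule cox_eq_equivp)

lemma cox_eq_append_right: "cox_eq xs ys \<Longrightarrow> cox_eq (xs @ zs) (ys @ zs)"
proof (induction rule: cox_eq.induct)
  case (cox_square xs a ys)
  show ?case using cox_eq.cox_square[of xs a "ys @ zs"] by simp
next
  case (cox_cube a b xs ys)
  then show ?case using cox_eq.cox_cube[of a b xs "ys @ zs"] by simp
qed (auto intro: cox_refl cox_sym cox_trans)

lemma cox_eq_append_left: "cox_eq xs ys \<Longrightarrow> cox_eq (zs @ xs) (zs @ ys)"
proof (induction rule: cox_eq.induct)
  case (cox_square xs a ys)
  show ?case using cox_eq.cox_square[of "zs @ xs" a ys] by simp
next
  case (cox_cube a b xs ys)
  then show ?case using cox_eq.cox_cube[of a b "zs @ xs" ys] by simp
qed (auto intro: cox_refl cox_sym cox_trans)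

lemma cox_eq_rev: "cox_eq xs ys \<Longrightarrow> cox_eq (rev xs) (rev ys)"
proof (induction rule: cox_eq.induct)
  case (cox_square xs a ys)
  show ?case using cox_eq.cox_square[of "rev ys" a "rev xs"] by simp
next
  case (cox_cube a b xs ys)
  then show ?case using cox_eq.cox_cube[of b a "rev ys" "rev xs"] by simp
qed (auto intro: cox_refl cox_sym cox_trans)

instantiation weyl :: monoid_mult
begin

lift_definition one_weyl :: weyl is "[]" .

lift_definition times_weyl :: "weyl \<Rightarrow> weyl \<Rightarrow> weyl" is "(@)"
  by (meson cox_eq_append_left cox_eq_append_right cox_trans)

instance
  by standard (transfer; simp add: cox_refl)+

end

lift_definition winv :: "weyl \<Rightarrow> weyl" is rev
  by (rule cox_eq_rev)

lift_definition word :: "gen list \<Rightarrow> weyl" is "\<lambda>xs. xs" .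

abbreviation simple :: "gen \<Rightarrow> weyl" where
  "simple a \<equiv> word [a]"

lemma winv_left: "winv w * w = 1"
proof transfer
  fix xs show "cox_eq (rev xs @ xs) []"
  proof (induction xs)
    case (Cons a xs)
    have "cox_eq (rev xs @ [a, a] @ xs) (rev xs @ xs)" by (rule cox_square)
    with Cons show ?case by (auto intro: cox_trans)
  qed (simp add: cox_refl)
qed

lemma winv_winv: "winv (winv w) = w"
  by transfer (simp add: cox_refl)

lemma winv_right: "w * winv w = 1"
  using winv_left[of "winv w"] by (simp add: winv_winv)

definition len :: "weyl \<Rightarrow> nat" where
  "len w = (LEAST n. \<exists>xs. word xs = w \<and> length xs = n)"

definition reduced :: "gen list \<Rightarrow> bool" where
  "reduced xs \<longleftrightarrow> length xs = len (word xs)"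

definition reflections :: "weyl set" where
  "reflections = {x * simple a * winv x | x a. True}"

definition bruhat_step :: "weyl \<Rightarrow> weyl \<Rightarrow> bool" where
  "bruhat_step u w \<longleftrightarrow> (\<exists>t\<in>reflections. w = u * t) \<and> len u < len w"

definition bruhat_le :: "weyl \<Rightarrow> weyl \<Rightarrow> bool" where
  "bruhat_le = bruhat_step\<^sup>*\<^sup>*"

definition bruhat_less :: "weyl \<Rightarrow> weyl \<Rightarrow> bool" where
  "bruhat_less u w \<longleftrightarrow> bruhat_le u w \<and> u \<noteq> w"

section \<open>The Hecke algebra\<close>

text \<open>Laurent polynomials over the integers in the indeterminate \<open>v = q\<^sup>1\<^sup>/\<^sup>2\<close>; the key \<open>k\<close> stands
  for \<open>v\<^sup>k\<close>, and the product is the convolution product of finitely supported functions.\<close>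

type_synonym laurent = "int \<Rightarrow>\<^sub>0 int"

definition vpow :: "int \<Rightarrow> laurent" where
  "vpow k = Poly_Mapping.single k 1"

definition laurent_bar :: "laurent \<Rightarrow> laurent" where
  "laurent_bar = Poly_Mapping.map_key uminus"

definition poly_in_q :: "int poly \<Rightarrow> laurent" where
  "poly_in_q p = (\<Sum>i\<le>degree p. Poly_Mapping.single (2 * int i) (coeff p i))"

text \<open>An element of the Hecke algebra is the family of its coordinates in the standard basis
  \<open>T\<^sub>w\<close>.\<close>

type_synonym hecke = "weyl \<Rightarrow>\<^sub>0 laurent"

definition hscale :: "laurent \<Rightarrow> hecke \<Rightarrow> hecke" where
  "hscale a h = Poly_Mapping.map (\<lambda>b. a * b) h"

definition T_basis :: "weyl \<Rightarrow> hecke" where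
  "T_basis w = Poly_Mapping.single w 1"

definition T_simple_mult :: "gen \<Rightarrow> hecke \<Rightarrow> hecke" where
  "T_simple_mult a h = (\<Sum>w\<in>Poly_Mapping.keys h. hscale (Poly_Mapping.lookup h w)
     (if len w < len (simple a * w) then T_basis (simple a * w)
      else hscale (vpow 2) (T_basis (simple a * w)) + hscale (vpow 2 - 1) (T_basis w)))"

definition reduced_word :: "weyl \<Rightarrow> gen list" where
  "reduced_word w = (SOME xs. reduced xs \<and> word xs = w)"

text \<open>The bilinear product with \<open>T\<^sub>x h = T\<^sub>a (T\<^sub>b (\<dots> h))\<close> for a reduced expression \<open>x = a b \<dots>\<close>; by
  the braid relations the result does not depend on the expression chosen.\<close>

definition hmult :: "hecke \<Rightarrow> hecke \<Rightarrow> hecke" where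
  "hmult h h' = (\<Sum>x\<in>Poly_Mapping.keys h.
     hscale (Poly_Mapping.lookup h x) (foldr T_simple_mult (reduced_word x) h'))"

definition T_inverse :: "weyl \<Rightarrow> hecke" where
  "T_inverse w = (THE h. hmult h (T_basis w) = T_basis 1 \<and> hmult (T_basis w) h = T_basis 1)"

definition hecke_bar :: "hecke \<Rightarrow> hecke" where
  "hecke_bar h = (\<Sum>w\<in>Poly_Mapping.keys h.
     hscale (laurent_bar (Poly_Mapping.lookup h w)) (T_inverse (winv w)))"

section \<open>Kazhdan--Lusztig polynomials\<close>

definition kl_element :: "(weyl \<Rightarrow> weyl \<Rightarrow> int poly) \<Rightarrow> weyl \<Rightarrow> hecke" where
  "kl_element P w =
     hscale (vpow (- int (len w))) (\<Sum>y\<in>{y. bruhat_le y w}. hscale (poly_in_q (P y w)) (T_basis y))"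

definition is_kl_family :: "(weyl \<Rightarrow> weyl \<Rightarrow> int poly) \<Rightarrow> bool" where
  "is_kl_family P \<longleftrightarrow>
     (\<forall>w. P w w = 1) \<and>
     (\<forall>y w. \<not> bruhat_le y w \<longrightarrow> P y w = 0) \<and>
     (\<forall>y w. bruhat_less y w \<longrightarrow> 2 * degree (P y w) + 1 \<le> len w - len y) \<and>
     (\<forall>w. hecke_bar (kl_element P w) = kl_element P w)"

definition KL :: "weyl \<Rightarrow> weyl \<Rightarrow> int poly" where
  "KL = (THE P. is_kl_family P)"

text \<open>If \<open>len w - len u\<close> is even, the exponent \<open>(len w - len u - 1) / 2\<close> is not an integer and
  the coefficient is zero.\<close>

definition mu :: "weyl \<Rightarrow> weyl \<Rightarrow> int" where
  "mu u w = (if odd (len w - len u) then coeff (KL u w) ((len w - len u - 1) div 2) else 0)"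

section \<open>Lusztig's a-function and the two-sided cells\<close>

definition C_basis :: "weyl \<Rightarrow> hecke" where
  "C_basis w = kl_element KL w"

definition structure_const :: "weyl \<Rightarrow> weyl \<Rightarrow> weyl \<Rightarrow> laurent" where
  "structure_const x y = Poly_Mapping.lookup (THE h :: weyl \<Rightarrow>\<^sub>0 laurent.
     hmult (C_basis x) (C_basis y) = (\<Sum>z\<in>Poly_Mapping.keys h. hscale (Poly_Mapping.lookup h z) (C_basis z)))"

text \<open>The least \<open>i \<ge> 0\<close> such that \<open>v\<^sup>i h\<^sub>x\<^sub>,\<^sub>y\<^sub>,\<^sub>z\<close> is a polynomial in \<open>v\<close> for all \<open>x\<close> and \<open>y\<close>
  (infinity if there is none).\<close>

definition a_fun :: "weyl \<Rightarrow> enat" where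
  "a_fun z = Inf {enat i | i.
     \<forall>x y. \<forall>k\<in>Poly_Mapping.keys (vpow (int i) * structure_const x y z). 0 \<le> k}"

definition c1 :: "weyl set" where
  "c1 = {w. a_fun w = 1}"

definition c0 :: "weyl set" where
  "c0 = {w. a_fun w = 3}"

end

theory Submission
  imports Defs
begin

text \<open>
  Write \<open>L(w)\<close> and \<open>R(w)\<close> for the left and right descent sets and \<open>p\<^sub>y\<^sub>,\<^sub>w\<close> for the coefficients of
  \<open>C\<^sub>w\<close> in the normalised standard basis; \<open>\<mu>(y, w)\<close> is the coefficient of \<open>v\<^sup>-\<^sup>1\<close> in \<open>p\<^sub>y\<^sub>,\<^sub>w\<close>. If
  \<open>a \<in> L(w) - L(y)\<close>, then \<open>p\<^sub>y\<^sub>,\<^sub>w = v\<^sup>-\<^sup>1 p\<^sub>a\<^sub>y\<^sub>,\<^sub>w\<close>, so \<open>\<mu>(y, w) = 0\<close> unless \<open>w = a y\<close>. For \<open>u \<in> c\<^sub>1\<close> and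
  \<open>w \<in> c\<^sub>0\<close> this leaves the case \<open>L(u) = L(w) = {a}\<close>, \<open>R(u) = R(w) = {e}\<close>. In type \<open>A\<^sub>2\<close> affine
  one then has \<open>w = a m e\<close> with \<open>L(m) = S - {a}\<close>, \<open>R(m) = S - {e}\<close> and \<open>C\<^sub>w = C\<^sub>a C\<^sub>m C\<^sub>e\<close>, so \<open>p\<^sub>u\<^sub>,\<^sub>w\<close>
  is a combination of the \<open>p\<^sub>y\<^sub>,\<^sub>m\<close> with \<open>y\<close> among \<open>u, a u, u e, a u e\<close>. Since \<open>m\<close> has two descents on
  either side while \<open>y\<close> has at most one, these are divisible by powers of \<open>v\<^sup>-\<^sup>1\<close> large enough to
  kill the coefficient.

  The values of the \<open>a\<close>-function are separated as follows. A braided element occurs in some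
  \<open>C\<^sub>x C\<^sub>y\<close> with coefficient \<open>(v + v\<^sup>-\<^sup>1)\<^sup>2\<close>. Conversely, the \<open>C\<^sub>w\<close> with \<open>w\<close> braided span a two-sided
  ideal, modulo which \<open>C\<^sub>x C\<^sub>y\<close> has coefficients in \<open>\<int> + (v + v\<^sup>-\<^sup>1) \<int>\<close>.

  The Hecke algebra acts on itself by left multiplications commuting with right ones, and a map
  commuting with the latter is determined by its value at 1: this gives associativity and the
  independence of the chosen reduced words.
\<close>

section \<open>The Coxeter group\<close>

lemma word_Nil: "word [] = 1"
  by transfer (rule cox_refl)

lemma word_append: "word (xs @ ys) = word xs * word ys"
  by transfer (rule cox_refl)

lemma word_Cons: "word (a # xs) = simple a * word xs"
  using word_append[of "[a]" xs] by simp

text \<open>As \<open>simple a\<close> unfolds to \<open>word [a]\<close>, the previous equation loops as a rewrite rule.\<close>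

lemma word_Cons_Cons: "word (a # b # xs) = simple a * word (b # xs)"
  by (rule word_Cons)

lemma winv_word: "winv (word xs) = word (rev xs)"
  by transfer (rule cox_refl)

lemma word_surj: "\<exists>xs. word xs = w"
  by transfer (auto intro: cox_refl)

lemma word_eq_iff: "word xs = word ys \<longleftrightarrow> cox_eq xs ys"
  by transfer simp

interpretation weyl_group: group "(*)" "1 :: weyl" winv
  by standard (simp_all add: winv_left)

lemmas winv_mult = weyl_group.inverse_distrib_swap

lemma winv_eq_iff [simp]: "winv x = winv y \<longleftrightarrow> x = y"
  by (metis weyl_group.inverse_inverse)

lemma winv_eq_one_iff [simp]: "winv x = 1 \<longleftrightarrow> x = 1"
  using winv_eq_iff[of x 1] by simp

lemma winv_cancel [simp]: "winv x * (x * y) = y" "x * (winv x * y) = y"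
  by (simp_all add: mult.assoc[symmetric])

lemma mult_mult_eq_iff: "x * (z * y) = u \<longleftrightarrow> z = winv x * (u * winv y)" for x y z u :: weyl
  by (metis mult.assoc mult.right_neutral winv_cancel weyl_group.left_inverse
    weyl_group.right_inverse)

lemma winv_simple [simp]: "winv (simple a) = simple a"
  by (simp add: winv_word)

lemma simple_square [simp]: "simple a * simple a = 1"
  by (metis weyl_group.left_inverse winv_simple)

lemma simple_cancel [simp]: "simple a * (simple a * w) = w"
  by (simp add: mult.assoc[symmetric])

lemma simple_mult_eq_iff: "simple a * x = y \<longleftrightarrow> x = simple a * y"
  by auto

lemma braid:
  assumes "a \<noteq> b"
  shows "simple a * (simple b * (simple a * w)) = simple b * (simple a * (simple b * w))"
proof -
  have "word [a,b,a,b,a,b] = 1"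
    using cox_cube[OF assms, of "[]" "[]"] by (simp add: word_eq_iff word_Nil[symmetric])
  then have "word [a,b,a,b,a,b] * (simple b * (simple a * (simple b * w))) =
      simple b * (simple a * (simple b * w))"
    by simp
  then show ?thesis by (simp add: word_Cons_Cons mult.assoc)
qed

subsection \<open>Inversions\<close>

text \<open>The parity of the number of occurrences of \<open>t\<close> among the reflections
  \<open>a\<^sub>1 \<dots> a\<^sub>i\<^sub>-\<^sub>1 a\<^sub>i a\<^sub>i\<^sub>-\<^sub>1 \<dots> a\<^sub>1\<close> attached to a word depends only on the group element. The
  resulting cocycle does the work of the strong exchange condition.\<close>

primrec inversion_parity :: "gen list \<Rightarrow> weyl \<Rightarrow> bool" where
  "inversion_parity [] t = False"
| "inversion_parity (a # xs) t = ((t = simple a) \<noteq> inversion_parity xs (simple a * t * simple a))"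

lemma inversion_parity_append:
  "inversion_parity (xs @ ys) t =
     (inversion_parity xs t \<noteq> inversion_parity ys (winv (word xs) * t * word xs))"
proof (induction xs arbitrary: t)
  case (Cons a xs)
  then show ?case by (auto simp: word_Cons[of a xs] winv_mult mult.assoc)
qed (simp add: word_Nil)

lemma inversion_parity_cox_eq:
  "cox_eq xs ys \<Longrightarrow> inversion_parity xs t = inversion_parity ys t"
proof (induction arbitrary: t rule: cox_eq.induct)
  case (cox_square xs a ys)
  have "inversion_parity ([a,a] @ ys) t = inversion_parity ys t" for t
    using mult_mult_eq_iff[of "simple a" t "simple a" "simple a"] by (auto simp: mult.assoc)
  then show ?case
    by (simp add: inversion_parity_append[of xs] del: append.simps)
next
  case (cox_cube a b xs ys)
  let ?a = "simple a" and ?b = "simple b"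
  have braid_mult: "?a * (?b * (?a * w)) = ?b * (?a * (?b * w))" for w
    by (rule braid[OF cox_cube])
  have braid_eq: "?a * (?b * ?a) = ?b * (?a * ?b)"
    using braid_mult[of 1] by simp
  \<comment> \<open>the six reflections attached to \<open>a b a b a b\<close> coincide in pairs\<close>
  have "inversion_parity ([a,b,a,b,a,b] @ ys) t = inversion_parity ys t" for t
    using mult_mult_eq_iff[of ?a t ?a ?b] mult_mult_eq_iff[of "?b * ?a" t "?a * ?b" ?a]
      mult_mult_eq_iff[of "?b * (?a * ?b)" t "?b * (?a * ?b)" ?b]
      mult_mult_eq_iff[of "?a * ?b" t "?b * ?a" ?a] mult_mult_eq_iff[of ?b t ?b ?b]
    by (auto simp: mult.assoc winv_mult braid_mult braid_eq)
  then show ?case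
    by (simp add: inversion_parity_append[of xs] del: append.simps)
qed auto

lift_definition inversion :: "weyl \<Rightarrow> weyl \<Rightarrow> bool" is inversion_parity
  by (rule ext) (rule inversion_parity_cox_eq)

lemma inversion_word: "inversion (word xs) t = inversion_parity xs t"
  by (simp add: inversion.abs_eq word_def)

lemma inversion_one [simp]: "\<not> inversion 1 t"
  using inversion_word[of "[]"] by (simp add: word_Nil)

lemma inversion_simple [simp]: "inversion (simple a) t \<longleftrightarrow> t = simple a"
  using inversion_word[of "[a]"] by simp

lemma inversion_mult: "inversion (x * y) t = (inversion x t \<noteq> inversion y (winv x * t * x))"
proof -
  obtain xs ys where "x = word xs" "y = word ys" by (metis word_surj)
  then show ?thesis
    by (simp add: inversion_word inversion_parity_append flip: word_append)
qed

lemma inversion_winv: "inversion (winv x) t = inversion x (x * t * winv x)"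
  using inversion_mult[of "winv x" x t] by simp

lemma inversion_parity_deletion:
  "inversion_parity xs t \<Longrightarrow> \<exists>ys b zs. xs = ys @ b # zs \<and> t * word xs = word (ys @ zs)"
proof (induction xs arbitrary: t)
  case (Cons a xs)
  show ?case
  proof (cases "t = simple a")
    case True
    then have "a # xs = [] @ a # xs \<and> t * word (a # xs) = word ([] @ xs)"
      by (simp add: word_Cons[of a xs])
    then show ?thesis by blast
  next
    case False
    with Cons.prems have "inversion_parity xs (simple a * t * simple a)" by simp
    with Cons.IH obtain ys b zs where xs: "xs = ys @ b # zs"
      and deleted: "simple a * t * simple a * word xs = word (ys @ zs)" by blast
    have "t * word (a # xs) = simple a * (simple a * t * simple a * word xs)"
      by (simp add: word_Cons[of a xs] mult.assoc)
    then have "t * word (a # xs) = word ((a # ys) @ zs)"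
      by (simp add: deleted word_Cons[of a "ys @ zs"])
    with xs show ?thesis by (metis append_Cons)
  qed
qed simp

lemma reflection_involution: "t \<in> reflections \<Longrightarrow> t * t = 1 \<and> winv t = t"
  by (auto simp: reflections_def mult.assoc winv_mult)

lemma reflection_cancel: "t \<in> reflections \<Longrightarrow> t * (t * w) = w"
  by (simp add: mult.assoc[symmetric] reflection_involution)

lemma simple_reflection: "simple a \<in> reflections"
  by (force simp: reflections_def intro: exI[of _ 1])

lemma conj_reflection: "t \<in> reflections \<Longrightarrow> x * t * winv x \<in> reflections"
  by (auto simp: reflections_def) (metis mult.assoc winv_mult)

lemma inversion_reflection_self:
  assumes "t \<in> reflections" shows "inversion t t"
proof -
  obtain x a where t: "t = x * (simple a * winv x)"
    using assms by (auto simp: reflections_def mult.assoc)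
  have "inversion t t = (inversion x t \<noteq> (True \<noteq> inversion x (x * (simple a * winv x))))"
    unfolding t by (simp add: inversion_mult inversion_winv mult.assoc)
  then show ?thesis using t by simp
qed

lemma inversion_reflection_mult:
  "t \<in> reflections \<Longrightarrow> inversion (t * w) t \<longleftrightarrow> \<not> inversion w t"
  by (simp add: inversion_mult inversion_reflection_self reflection_involution)

subsection \<open>Length\<close>

lemma len_word_le: "len (word xs) \<le> length xs"
  unfolding len_def by (rule Least_le) auto

lemma ex_reduced: "\<exists>xs. word xs = w \<and> length xs = len w"
proof -
  have "\<exists>n xs. word xs = w \<and> length xs = n" using word_surj by blast
  then show ?thesis unfolding len_def by (rule LeastI_ex)
qed

lemma len_mult_le: "len (x * y) \<le> len x + len y"
  by (metis ex_reduced len_word_le word_append length_append)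

lemma len_one [simp]: "len 1 = 0"
  using len_word_le[of "[]"] by (simp add: word_Nil)

lemma len_eq_0_iff [simp]: "len w = 0 \<longleftrightarrow> w = 1"
  by (metis ex_reduced len_one length_0_conv word_Nil)

lemma len_winv [simp]: "len (winv w) = len w"
  by (metis ex_reduced le_antisym len_word_le length_rev weyl_group.inverse_inverse winv_word)

lemma inversion_imp_len_less:
  assumes "inversion w t" shows "len (t * w) < len w"
proof -
  obtain xs where xs: "word xs = w" "length xs = len w" using ex_reduced by blast
  with assms obtain ys b zs where "xs = ys @ b # zs" "t * word xs = word (ys @ zs)"
    using inversion_parity_deletion inversion_word by blast
  with xs len_word_le[of "ys @ zs"] show ?thesis by simp
qed

lemma inversion_iff_len_less:
  assumes t: "t \<in> reflections" shows "inversion w t \<longleftrightarrow> len (t * w) < len w"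
proof
  assume "len (t * w) < len w"
  then show "inversion w t"
    using inversion_imp_len_less[of "t * w" t] inversion_reflection_mult[OF t, of w]
      reflection_cancel[OF t, of w]
    by auto
qed (rule inversion_imp_len_less)

lemma len_reflection_neq:
  "t \<in> reflections \<Longrightarrow> len (t * w) \<noteq> len w"
  using inversion_reflection_mult[of t w] by (auto simp: inversion_iff_len_less reflection_cancel)

lemma len_simple [simp]: "len (simple a) = 1"
  using len_word_le[of "[a]"] len_reflection_neq[OF simple_reflection, of a 1]
  by (simp add: le_Suc_eq)

lemma len_simple_mult: "len (simple a * w) = len w + 1 \<or> len w = len (simple a * w) + 1"
  using len_mult_le[of "simple a" w] len_mult_le[of "simple a" "simple a * w"]
    len_reflection_neq[OF simple_reflection, of a w] by auto

lemma simple_mult_neq [simp]: "simple a * w \<noteq> w" "w \<noteq> simple a * w"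
  using len_simple_mult[of a w] by auto

lemma finite_len_le: "finite {w. len w \<le> n}"
proof (rule finite_subset)
  show "{w. len w \<le> n} \<subseteq> word ` {xs. set xs \<subseteq> {GR, GS, GT} \<and> length xs \<le> n}"
  proof
    fix w assume "w \<in> {w. len w \<le> n}"
    moreover obtain xs where "word xs = w" "length xs = len w" using ex_reduced by blast
    moreover have "set xs \<subseteq> {GR, GS, GT}" using gen.exhaust by blast
    ultimately show "w \<in> word ` {xs. set xs \<subseteq> {GR, GS, GT} \<and> length xs \<le> n}" by auto
  qed
  show "finite (word ` {xs. set xs \<subseteq> {GR, GS, GT} \<and> length xs \<le> n})"
    by (intro finite_imageI finite_lists_length_le) simp
qed

subsection \<open>Generators\<close>

text \<open>The quotient \<open>S\<^sub>3\<close> of the group separates the generators.\<close>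

fun swap_others :: "gen \<Rightarrow> gen \<Rightarrow> gen" where
  "swap_others GR GR = GR" | "swap_others GR GS = GT" | "swap_others GR GT = GS"
| "swap_others GS GR = GT" | "swap_others GS GS = GS" | "swap_others GS GT = GR"
| "swap_others GT GR = GS" | "swap_others GT GS = GR" | "swap_others GT GT = GT"

lemma foldr_swap_others_cox_eq: "cox_eq xs ys \<Longrightarrow> foldr swap_others xs = foldr swap_others ys"
proof (induction rule: cox_eq.induct)
  case (cox_square xs a ys)
  have "swap_others a (swap_others a x) = x" for x
    by (cases x; cases a) auto
  then show ?case by (simp add: fun_eq_iff)
next
  case (cox_cube a b xs ys)
  then have "foldr swap_others [a, b, a, b, a, b] x = x" for x
    by (cases x; cases a; cases b) auto
  then show ?case by (simp add: fun_eq_iff)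
qed auto

lemma simple_inj [simp]: "simple a = simple b \<longleftrightarrow> a = b"
proof
  assume "simple a = simple b"
  then have "swap_others a x = swap_others b x" for x
    using foldr_swap_others_cox_eq[of "[a]" "[b]"] by (simp add: word_eq_iff fun_eq_iff)
  from this[of GR] this[of GS] show "a = b" by (cases a; cases b) auto
qed simp

lemma gen_exhaust_distinct: "p \<noteq> q \<Longrightarrow> p \<noteq> r \<Longrightarrow> q \<noteq> r \<Longrightarrow> x = p \<or> x = q \<or> x = r" for x :: gen
  by (cases x; cases p; cases q; cases r) auto

lemma obtain_third_gen: obtains r :: gen where "r \<noteq> p" "r \<noteq> q"
  by (cases p; cases q) (metis gen.distinct)+

lemma obtain_other_gens: obtains q r :: gen where "q \<noteq> p" "r \<noteq> p" "q \<noteq> r"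
  by (cases p) (metis gen.distinct)+

subsection \<open>Descents\<close>

definition descents :: "weyl \<Rightarrow> gen set" where
  "descents w = {a. len (simple a * w) < len w}"

definition right_descents :: "weyl \<Rightarrow> gen set" where
  "right_descents w = {a. len (w * simple a) < len w}"

lemma descents_iff: "a \<in> descents w \<longleftrightarrow> len (simple a * w) < len w"
  by (simp add: descents_def)

lemma descents_inversion_iff: "a \<in> descents w \<longleftrightarrow> inversion w (simple a)"
  by (simp add: descents_iff inversion_iff_len_less simple_reflection)

lemma descents_winv [simp]: "descents (winv w) = right_descents w"
proof -
  have "len (simple a * winv w) = len (w * simple a)" for a
    using len_winv[of "w * simple a"] by (simp add: winv_mult)
  then show ?thesis by (simp add: descents_def right_descents_def)
qed

lemma right_descents_winv [simp]: "right_descents (winv w) = descents w"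
  using descents_winv[of "winv w"] by simp

lemma len_descent: "a \<in> descents w \<Longrightarrow> len w = len (simple a * w) + 1"
  using len_simple_mult[of a w] by (auto simp: descents_iff)

lemma len_ascent: "a \<notin> descents w \<Longrightarrow> len (simple a * w) = len w + 1"
  using len_simple_mult[of a w] by (auto simp: descents_iff)

lemma len_right_descent: "a \<in> right_descents w \<Longrightarrow> len w = len (w * simple a) + 1"
  using len_descent[of a "winv w"] len_winv[of "w * simple a"] by (simp add: winv_mult)

lemma descents_simple_mult [simp]: "a \<in> descents (simple a * w) \<longleftrightarrow> a \<notin> descents w"
  using len_simple_mult[of a w] by (auto simp: descents_iff)

lemma right_descents_mult_simple [simp]: "a \<in> right_descents (w * simple a) \<longleftrightarrow> a \<notin> right_descents w"
  using len_simple_mult[of a "winv w"] len_winv[of "w * simple a"]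
  by (auto simp: right_descents_def winv_mult mult.assoc)

lemma descents_mult_simple:
  "a \<in> descents (w * simple b) \<longleftrightarrow> (a \<in> descents w) \<noteq> (simple a * w = w * simple b)"
proof -
  have "winv w * simple a * w = simple b \<longleftrightarrow> simple a * w = w * simple b"
    using mult_mult_eq_iff[of "winv w" "simple a" w "simple b"]
    by (metis mult.assoc winv_cancel)
  then show ?thesis by (simp add: descents_inversion_iff inversion_mult)
qed

lemma right_descents_simple_mult:
  "b \<in> right_descents (simple a * w) \<longleftrightarrow> (b \<in> right_descents w) \<noteq> (simple a * w = w * simple b)"
proof -
  have "simple b * winv w = winv w * simple a \<longleftrightarrow> simple a * w = w * simple b"
    using winv_eq_iff[of "simple a * w" "w * simple b"] by (auto simp: winv_mult)
  then show ?thesis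
    using descents_mult_simple[of b "winv w" a] descents_winv[of "simple a * w"]
    by (simp add: winv_mult)
qed

lemma descents_one [simp]: "descents 1 = {}"
  by (auto simp: descents_iff)

lemma descents_simple [simp]: "descents (simple p) = {p}"
  by (auto simp: descents_inversion_iff)

lemma descents_nonempty:
  assumes "w \<noteq> 1" obtains a where "a \<in> descents w"
proof -
  obtain xs where xs: "word xs = w" "length xs = len w" using ex_reduced by blast
  with assms obtain a ys where ys: "xs = a # ys" by (cases xs) (auto simp: word_Nil)
  then have "simple a * w = word ys" using xs(1) word_Cons[of a ys] by auto
  then have "a \<in> descents w" using len_word_le[of ys] xs ys by (simp add: descents_iff)
  then show thesis by (rule that)
qed

lemma right_descents_nonempty:
  assumes "w \<noteq> 1" obtains a where "a \<in> right_descents w"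
  using assms descents_nonempty[of "winv w"] by auto

lemma obtain_ascent_factor:
  assumes "w \<noteq> 1" obtains a x where "w = simple a * x" "a \<notin> descents x" "len w = len x + 1"
proof -
  obtain a where a: "a \<in> descents w" using assms by (rule descents_nonempty)
  show thesis by (rule that[of a "simple a * w"]) (use a len_descent[OF a] in auto)
qed

lemma ascent_induct [case_names one ascent]:
  assumes "P 1" "\<And>a w. a \<notin> descents w \<Longrightarrow> P w \<Longrightarrow> P (simple a * w)"
  shows "P w"
proof (induction "len w" arbitrary: w)
  case 0
  then show ?case using assms(1) by simp
next
  case (Suc n)
  then obtain a x where "w = simple a * x" "a \<notin> descents x" "len w = len x + 1"
    by (metis len_one nat.distinct(1) obtain_ascent_factor)
  then show ?case using Suc assms(2) by simp
qed

lemma descents_subset_mult: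
  assumes "len (x * y) = len x + len y" shows "descents x \<subseteq> descents (x * y)"
proof
  fix a assume "a \<in> descents x"
  then show "a \<in> descents (x * y)"
    using assms len_mult_le[of "simple a * x" y] by (simp add: descents_iff mult.assoc)
qed

lemma right_descents_subset_mult:
  assumes "len (x * y) = len x + len y" shows "right_descents y \<subseteq> right_descents (x * y)"
  using descents_subset_mult[of "winv y" "winv x"] assms len_winv[of "x * y"]
    descents_winv[of "x * y"]
  by (simp add: winv_mult)

lemma right_descents_simple_mult_subset:
  "a \<in> descents w \<Longrightarrow> right_descents (simple a * w) \<subseteq> right_descents w"
  using right_descents_subset_mult[of "simple a" "simple a * w"] len_descent[of a w] by simp

lemma descents_mult_simple_subset:
  "a \<in> right_descents w \<Longrightarrow> descents (w * simple a) \<subseteq> descents w"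
  using right_descents_simple_mult_subset[of a "winv w"] right_descents_winv[of "w * simple a"]
  by (simp add: winv_mult)

subsection \<open>Dihedral parabolic subgroups\<close>

definition longest :: "gen \<Rightarrow> gen \<Rightarrow> weyl" where
  "longest p q = simple p * (simple q * simple p)"

lemma longest_mult: "longest p q * w = simple p * (simple q * (simple p * w))"
  by (simp add: longest_def mult.assoc)

lemma longest_commute: "p \<noteq> q \<Longrightarrow> longest p q = longest q p"
  using braid[of p q 1] by (simp add: longest_def)

lemma longest_longest_mult [simp]: "longest p q * (longest p q * w) = w"
  by (simp add: longest_mult)

lemma winv_longest [simp]: "winv (longest p q) = longest p q"
  by (simp add: longest_def winv_mult mult.assoc)

lemma len_longest_le: "len (longest p q) \<le> 3"
  using len_mult_le[of "simple p" "simple q * simple p"] len_mult_le[of "simple q" "simple p"]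
  by (simp add: longest_def)

lemma len_longest_mult_of_descent:
  assumes "q \<in> descents (simple p * w)" "p \<notin> descents w" "q \<noteq> p"
  shows "len (longest p q * w) + 1 = len w"
proof -
  have "inversion w (longest p q)"
    using assms(1,3) by (simp add: descents_inversion_iff inversion_mult longest_def mult.assoc)
  then have "len (longest p q * w) < len w" by (rule inversion_imp_len_less)
  moreover have "len (simple p * (longest p q * w)) = len w"
    using len_descent[OF assms(1)] len_ascent[OF assms(2)] by (simp add: longest_mult)
  ultimately show ?thesis using len_simple_mult[of p "longest p q * w"] by linarith
qed

lemma len_simple_simple_mult_of_descents:
  assumes "p \<in> descents w" "q \<in> descents w" "p \<noteq> q"
  shows "len (simple p * (simple q * w)) + 2 = len w"
  using len_longest_mult_of_descent[of q p "simple p * w"] assms len_descent[OF assms(1)]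
  by (simp add: longest_mult)

lemma len_longest_mult_of_descents:
  assumes "p \<in> descents w" "q \<in> descents w" "p \<noteq> q"
  shows "len (longest p q * w) + 3 = len w"
proof -
  define u where "u = simple q * (simple p * w)"
  have len_u: "len u + 2 = len w"
    unfolding u_def using len_simple_simple_mult_of_descents assms by metis
  have "p \<in> descents u"
  proof (rule ccontr)
    assume not_p: "p \<notin> descents u"
    have "simple q * (simple p * u) = simple p * (simple q * w)"
      using braid[of q p "simple p * w"] assms(3) by (simp add: u_def)
    then have "q \<in> descents (simple p * u)"
      using len_u len_simple_simple_mult_of_descents[OF assms] len_ascent[OF not_p]
      by (simp add: descents_iff)
    then have "len (longest p q * u) + 1 = len u"
      using not_p assms(3) by (intro len_longest_mult_of_descent) auto
    moreover have "longest p q * u = simple q * w"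
      using braid[of q p "simple p * w"] assms(3) by (simp add: longest_mult u_def)
    ultimately show False using len_u len_descent[OF assms(2)] by simp
  qed
  then show ?thesis using len_descent[of p u] len_u by (simp add: longest_mult u_def)
qed

lemma obtain_longest_factor:
  assumes "p \<in> descents w" "q \<in> descents w" "p \<noteq> q"
  obtains y where "w = longest p q * y" "len w = 3 + len y"
  by (rule that[of "longest p q * w"]) (use len_longest_mult_of_descents[OF assms] in auto)

lemma longest_ascents:
  assumes "p \<noteq> q" "p \<notin> descents y" "q \<notin> descents y"
  shows "q \<notin> descents (simple p * y)" "p \<notin> descents (simple q * (simple p * y))"
    "len (longest p q * y) = 3 + len y"
proof -
  have len_p: "len (simple p * y) = len y + 1" by (rule len_ascent[OF assms(2)])
  show q_ascent: "q \<notin> descents (simple p * y)"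
  proof
    assume "q \<in> descents (simple p * y)"
    then have "len (simple q * (simple p * (simple p * y))) + 2 = len (simple p * y)"
      using assms by (intro len_simple_simple_mult_of_descents) auto
    then show False using len_p len_ascent[OF assms(3)] by simp
  qed
  have len_qp: "len (simple q * (simple p * y)) = len y + 2"
    using len_ascent[OF q_ascent] len_p by simp
  show p_ascent: "p \<notin> descents (simple q * (simple p * y))"
  proof
    assume "p \<in> descents (simple q * (simple p * y))"
    then have "len (longest q p * (simple q * (simple p * y))) + 3 = len y + 2"
      using len_longest_mult_of_descents[of q "simple q * (simple p * y)" p] assms q_ascent len_qp
      by simp
    moreover have "longest q p * (simple q * (simple p * y)) = simple q * y"
      by (simp add: longest_mult)
    ultimately show False using len_ascent[OF assms(3)] by simp
  qed
  show "len (longest p q * y) = 3 + len y"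
    using len_ascent[OF p_ascent] len_qp by (simp add: longest_mult)
qed

lemma len_longest: "p \<noteq> q \<Longrightarrow> len (longest p q) = 3"
  using longest_ascents(3)[of p q 1] by simp

lemma descents_longest:
  assumes "p \<noteq> q" shows "{p, q} \<subseteq> descents (longest p q)"
proof -
  have "p \<in> descents (longest p q)" if "p \<noteq> q" for p q
    using longest_ascents(2)[OF that, of 1] by (simp add: longest_def)
  then show ?thesis using assms longest_commute by (metis insert_subset empty_subsetI)
qed

lemma descents_longest_mult:
  assumes "p \<noteq> q" "len (longest p q * y) = 3 + len y"
  shows "{p, q} \<subseteq> descents (longest p q * y)"
  using descents_subset_mult[of "longest p q" y] descents_longest[OF assms(1)] assms len_longest
  by auto

text \<open>The two descents of \<open>v\<close> cannot be prolonged by the third generator, because the corresponding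
  braid relation would again produce such a configuration, in an element that is shorter by 1.\<close>

lemma third_not_in_descents_simple_mult:
  assumes "p \<in> descents v" "q \<in> descents v" "p \<noteq> q" "r \<noteq> p" "r \<noteq> q"
  shows "r \<notin> descents (simple p * v)"
  using assms
proof (induction "len v" arbitrary: v p q r rule: less_induct)
  case less
  show ?case
  proof
    define v' where "v' = simple p * v"
    assume "r \<in> descents (simple p * v)"
    then have r: "r \<in> descents v'" by (simp add: v'_def)
    obtain y where v: "v = longest p q * y" "len v = 3 + len y"
      using obtain_longest_factor less.prems by metis
    then have v': "v' = simple q * (simple p * y)" "len v = len v' + 1"
      using less.prems len_descent[of p v] by (simp_all add: v'_def longest_mult)
    have "len (simple p * y) \<le> len y + 1" using len_mult_le[of "simple p" y] by simp
    then have q: "q \<in> descents v'" using v v' by (simp add: descents_iff)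
    have "p \<in> descents (simple q * v')"
      using v v' len_descent[OF q] by (simp add: descents_iff)
    moreover have "p \<notin> descents (simple q * v')"
      using less.hyps[of v' q r p] q r less.prems v'(2) by auto
    ultimately show False by simp
  qed
qed

lemma third_not_in_descents:
  assumes "p \<in> descents w" "q \<in> descents w" "p \<noteq> q" "r \<noteq> p" "r \<noteq> q"
  shows "r \<notin> descents w"
proof
  assume r: "r \<in> descents w"
  have "len (simple r * (simple p * w)) + 2 = len w"
    using len_simple_simple_mult_of_descents[OF r assms(1)] assms by auto
  then have "r \<in> descents (simple p * w)"
    using len_descent[OF assms(1)] by (simp add: descents_iff)
  with third_not_in_descents_simple_mult[OF assms] show False by simp
qed

subsection \<open>Braided elements\<close>

text \<open>The elements with a unique reduced expression are those that are not \<open>braided\<close>, so that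
  \<open>c\<^sub>0\<close> consists of the braided elements and \<open>c\<^sub>1\<close> of the \<open>rigid\<close> ones.\<close>

definition braided :: "weyl \<Rightarrow> bool" where
  "braided w \<longleftrightarrow> (\<exists>x p q y. p \<noteq> q \<and> w = x * longest p q * y \<and> len w = len x + 3 + len y)"

lemma braidedI:
  "p \<noteq> q \<Longrightarrow> w = x * longest p q * y \<Longrightarrow> len w = len x + 3 + len y \<Longrightarrow> braided w"
  unfolding braided_def by blast

lemma braidedE:
  assumes "braided w"
  obtains x p q y where "p \<noteq> q" "w = x * longest p q * y" "len w = len x + 3 + len y"
  using assms unfolding braided_def by blast

lemma len_braided: "braided w \<Longrightarrow> 3 \<le> len w"
  by (auto elim: braidedE)

lemma braided_not_one: "braided w \<Longrightarrow> w \<noteq> 1"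
  using len_braided by fastforce

lemma braided_winv [simp]: "braided (winv w) \<longleftrightarrow> braided w"
proof -
  have "braided (winv w)" if w: "braided w" for w
  proof -
    obtain x p q y where w: "p \<noteq> q" "w = x * longest p q * y" "len w = len x + 3 + len y"
      using w by (rule braidedE)
    have "winv w = winv y * longest p q * winv x" using w(2) by (simp add: winv_mult mult.assoc)
    moreover have "len (winv w) = len (winv y) + 3 + len (winv x)" using w(3) by simp
    ultimately show ?thesis using w(1) by (intro braidedI)
  qed
  from this[of w] this[of "winv w"] show ?thesis by auto
qed

lemma braided_two_descents:
  assumes "p \<in> descents w" "q \<in> descents w" "p \<noteq> q" shows "braided w"
proof -
  obtain y where "w = longest p q * y" "len w = 3 + len y"
    using assms by (rule obtain_longest_factor)
  then show ?thesis using assms(3) by (intro braidedI[of p q w 1 y]) simp_all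
qed

lemma braided_ascent:
  assumes "braided w" "a \<notin> descents w" shows "braided (simple a * w)"
proof -
  obtain x p q y where w: "p \<noteq> q" "w = x * longest p q * y" "len w = len x + 3 + len y"
    using assms(1) by (rule braidedE)
  have "len w + 1 \<le> len (simple a * x) + 3 + len y"
    using len_ascent[OF assms(2)] w(2) len_mult_le[of "simple a * x * longest p q" y]
      len_mult_le[of "simple a * x" "longest p q"] len_longest_le[of p q]
    by (simp add: mult.assoc)
  then have "len w + 1 = len (simple a * x) + 3 + len y"
    using w(3) len_mult_le[of "simple a" x] by simp
  then show ?thesis
    using w len_ascent[OF assms(2)]
    by (intro braidedI[of p q _ "simple a * x" y]) (simp_all add: mult.assoc)
qed

lemma not_braided_descent: "\<not> braided w \<Longrightarrow> a \<in> descents w \<Longrightarrow> \<not> braided (simple a * w)"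
  using braided_ascent[of "simple a * w" a] by auto

lemma not_braided_right_descent:
  "\<not> braided w \<Longrightarrow> a \<in> right_descents w \<Longrightarrow> \<not> braided (w * simple a)"
  using not_braided_descent[of "winv w" a] braided_winv[of "w * simple a"] by (simp add: winv_mult)

lemma braided_of_unique_descent:
  assumes "braided w" "descents w = {a}" shows "braided (simple a * w)"
proof -
  obtain x p q y where w: "p \<noteq> q" "w = x * longest p q * y" "len w = len x + 3 + len y"
    using assms(1) by (rule braidedE)
  have "x \<noteq> 1"
  proof
    assume "x = 1"
    then have "{p, q} \<subseteq> descents w" using descents_longest_mult[of p q y] w by simp
    then show False using assms(2) w(1) by auto
  qed
  then obtain d where d: "d \<in> descents x" by (rule descents_nonempty)
  have "len w = len x + len (longest p q * y)"
    using w len_mult_le[of x "longest p q * y"] len_mult_le[of "longest p q" y]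
      len_longest_le[of p q]
    by (simp add: mult.assoc)
  then have "d \<in> descents w"
    using descents_subset_mult[of x "longest p q * y"] d w(2) by (auto simp: mult.assoc)
  then have "d = a" using assms(2) by simp
  then have "len (simple a * w) = len (simple a * x) + 3 + len y"
    using len_descent[of a x] len_descent[of a w] d assms(2) w(3) by simp
  then show ?thesis
    using w by (intro braidedI[of p q _ "simple a * x" y]) (simp_all add: mult.assoc)
qed

lemma descents_of_unique_descent:
  "braided w \<Longrightarrow> descents w = {a} \<Longrightarrow> descents (simple a * w) = - {a}"
proof (induction "len w" arbitrary: w a rule: less_induct)
  case less
  define w' where "w' = simple a * w"
  have w: "w = simple a * w'" "len w = len w' + 1"
    using len_descent[of a w] less.prems by (simp_all add: w'_def)
  have w': "braided w'" "a \<notin> descents w'"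
    using less.prems braided_of_unique_descent by (simp_all add: w'_def)
  obtain b where b: "b \<in> descents w'" using braided_not_one[OF w'(1)] by (rule descents_nonempty)
  with w' have b_neq_a: "b \<noteq> a" by auto
  show ?case
  proof (cases "descents w' = {b}")
    case False
    then obtain c where c: "c \<in> descents w'" "c \<noteq> b" using b by auto
    then have "descents w' = - {a}" using b b_neq_a w' gen_exhaust_distinct[of a b c] by auto
    then show ?thesis by (simp add: w'_def)
  next
    case True
    obtain c where c: "c \<noteq> a" "c \<noteq> b" by (rule obtain_third_gen)
    have "descents (simple b * w') = - {b}" using less.hyps[of w' b] w w' True by simp
    then obtain y where y: "simple b * w' = longest a c * y" "len (simple b * w') = 3 + len y"
      using obtain_longest_factor[of a "simple b * w'" c] b_neq_a c by auto
    have "w = simple a * (simple b * (simple a * (simple c * (simple a * y))))"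
      using y(1) w(1) by (simp add: longest_mult simple_mult_eq_iff)
    then have "simple b * w = simple a * (simple b * (simple c * (simple a * y)))"
      using braid[of a b] b_neq_a by (simp add: simple_mult_eq_iff)
    then have "len (simple b * w) \<le> len y + 4"
      using len_mult_le[of "simple a" "simple b * (simple c * (simple a * y))"]
        len_mult_le[of "simple b" "simple c * (simple a * y)"]
        len_mult_le[of "simple c" "simple a * y"] len_mult_le[of "simple a" y] by simp
    then have "b \<in> descents w" using y w len_descent[OF b] by (simp add: descents_iff)
    then show ?thesis using b_neq_a less.prems by simp
  qed
qed

definition rigid :: "weyl \<Rightarrow> bool" where
  "rigid w \<longleftrightarrow> w \<noteq> 1 \<and> \<not> braided w"

lemma rigid_winv [simp]: "rigid (winv w) \<longleftrightarrow> rigid w"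
  by (simp add: rigid_def)

lemma rigid_descents: "rigid w \<Longrightarrow> a \<in> descents w \<Longrightarrow> descents w = {a}"
  using braided_two_descents by (auto simp: rigid_def)

lemma obtain_rigid_descent:
  assumes "rigid w" obtains a where "descents w = {a}"
  using assms rigid_descents descents_nonempty unfolding rigid_def by metis

subsection \<open>Bruhat order\<close>

lemma bruhat_step_len: "bruhat_step u w \<Longrightarrow> len u < len w"
  by (simp add: bruhat_step_def)

lemma bruhat_le_refl [simp]: "bruhat_le w w"
  by (simp add: bruhat_le_def)

lemma bruhat_le_trans: "bruhat_le x y \<Longrightarrow> bruhat_le y z \<Longrightarrow> bruhat_le x z"
  unfolding bruhat_le_def by simp

lemma bruhat_le_len: "bruhat_le u w \<Longrightarrow> u = w \<or> len u < len w"
  unfolding bruhat_le_def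
  by (induction rule: rtranclp_induct) (auto dest: bruhat_step_len)

lemma bruhat_less_len: "bruhat_less u w \<Longrightarrow> len u < len w"
  using bruhat_le_len unfolding bruhat_less_def by blast

lemma finite_bruhat_le: "finite {y. bruhat_le y w}"
  by (rule finite_subset[OF _ finite_len_le[of "len w"]]) (auto dest: bruhat_le_len)

lemma bruhat_step_left_iff:
  "bruhat_step u w \<longleftrightarrow> (\<exists>t\<in>reflections. w = t * u) \<and> len u < len w"
proof -
  have "(\<exists>t\<in>reflections. w = u * t) \<longleftrightarrow> (\<exists>t\<in>reflections. w = t * u)"
  proof
    assume "\<exists>t\<in>reflections. w = u * t"
    then obtain t where "t \<in> reflections" "w = u * t" by blast
    then have "u * t * winv u \<in> reflections" "w = u * t * winv u * u"
      by (blast intro: conj_reflection) (simp add: \<open>w = u * t\<close> mult.assoc)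
    then show "\<exists>t\<in>reflections. w = t * u" by blast
  next
    assume "\<exists>t\<in>reflections. w = t * u"
    then obtain t where "t \<in> reflections" "w = t * u" by blast
    then have "winv u * t * winv (winv u) \<in> reflections" "w = u * (winv u * t * winv (winv u))"
      by (blast intro: conj_reflection) (simp add: \<open>w = t * u\<close> mult.assoc)
    then show "\<exists>t\<in>reflections. w = u * t" by blast
  qed
  then show ?thesis by (simp add: bruhat_step_def)
qed

lemma bruhat_step_winv: "bruhat_step u w \<Longrightarrow> bruhat_step (winv u) (winv w)"
  unfolding bruhat_step_left_iff[of "winv u"] unfolding bruhat_step_def
  using reflection_involution by (auto simp: winv_mult)

lemma bruhat_le_winv: "bruhat_le (winv u) (winv w) \<longleftrightarrow> bruhat_le u w"
proof -
  have "bruhat_le u w \<Longrightarrow> bruhat_le (winv u) (winv w)" for u w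
    unfolding bruhat_le_def
    by (induction rule: rtranclp_induct) (auto dest: bruhat_step_winv)
  from this[of u w] this[of "winv u" "winv w"] show ?thesis by auto
qed

lemma bruhat_step_ascent: "a \<notin> descents w \<Longrightarrow> bruhat_step w (simple a * w)"
  using simple_reflection len_ascent by (auto simp: bruhat_step_left_iff)

lemma bruhat_step_simple_mult:
  assumes "bruhat_step u w" shows "simple a * u = w \<or> bruhat_step (simple a * u) (simple a * w)"
proof -
  obtain t where t: "t \<in> reflections" "w = t * u" "len u < len w"
    using assms unfolding bruhat_step_left_iff by blast
  define t' where "t' = simple a * t * simple a"
  have t': "t' \<in> reflections" "simple a * w = t' * (simple a * u)"
    using t conj_reflection[of t "simple a"] by (simp_all add: t'_def mult.assoc)
  have "inversion (simple a * u) t' = ((t' = simple a) \<noteq> inversion u t)"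
    by (simp add: inversion_mult t'_def mult.assoc)
  moreover have "\<not> inversion u t"
    using t by (simp add: inversion_iff_len_less)
  moreover have "t' = simple a \<longleftrightarrow> t = simple a"
    using mult_mult_eq_iff[of "simple a" t "simple a" "simple a"] by (simp add: t'_def mult.assoc)
  ultimately have "t = simple a \<or> \<not> len (simple a * w) < len (simple a * u)"
    using t' by (simp add: inversion_iff_len_less)
  then show ?thesis
    using t t' len_reflection_neq[OF t'(1), of "simple a * u"]
    unfolding bruhat_step_left_iff by fastforce
qed

lemma bruhat_le_lift:
  "bruhat_le u w \<Longrightarrow> bruhat_le (simple a * u) w \<or> bruhat_le (simple a * u) (simple a * w)"
  unfolding bruhat_le_def
proof (induction rule: rtranclp_induct)
  case (step x w)
  then show ?case using bruhat_step_simple_mult[OF step(2), of a]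
    by (metis rtranclp.rtrancl_into_rtrancl)
qed simp

lemma bruhat_le_ascent:
  assumes "bruhat_le u w" "a \<notin> descents w"
  shows "bruhat_le u (simple a * w)" "bruhat_le (simple a * u) (simple a * w)"
proof -
  have "bruhat_le w (simple a * w)"
    using bruhat_step_ascent[OF assms(2)] by (simp add: bruhat_le_def)
  then show "bruhat_le u (simple a * w)" "bruhat_le (simple a * u) (simple a * w)"
    using assms bruhat_le_lift bruhat_le_trans by blast+
qed

lemma bruhat_le_imp_step:
  assumes "bruhat_le u w" "len w = len u + 1" shows "bruhat_step u w"
proof -
  obtain x where x: "bruhat_le u x" "bruhat_step x w"
    using assms unfolding bruhat_le_def by (metis rtranclp.cases n_not_Suc_n Suc_eq_plus1)
  then have "x = u" using bruhat_le_len[OF x(1)] bruhat_step_len[OF x(2)] assms by auto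
  with x show ?thesis by simp
qed

section \<open>The Hecke algebra\<close>

abbreviation lookup :: "('a \<Rightarrow>\<^sub>0 'b::zero) \<Rightarrow> 'a \<Rightarrow> 'b" where
  "lookup \<equiv> Poly_Mapping.lookup"

abbreviation keys :: "('a \<Rightarrow>\<^sub>0 'b::zero) \<Rightarrow> 'a set" where
  "keys \<equiv> Poly_Mapping.keys"

subsection \<open>Laurent polynomials\<close>

lemma lookup_single_mult:
  fixes p :: "'a::ab_group_add \<Rightarrow>\<^sub>0 'b::semiring_0"
  shows "lookup (Poly_Mapping.single k c * p) n = c * lookup p (n - k)"
proof -
  have "(lookup p q when n = k + q) = (lookup p q when q = n - k)" for q
    by (auto simp: when_def algebra_simps)
  then show ?thesis
    by (simp add: lookup_mult lookup_single when_mult)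
qed

lemma lookup_vpow: "lookup (vpow k) n = (1 when n = k)"
  by (simp add: vpow_def lookup_single when_def)

lemma lookup_vpow_mult: "lookup (vpow k * p) n = lookup p (n - k)"
  by (simp add: vpow_def lookup_single_mult)

lemma lookup_of_int_mult: "lookup (of_int c * p :: laurent) n = c * lookup p n"
  using lookup_single_mult[of 0 c p n] single_of_int[of c, where 'b = int and 'a = int] by simp

lemma vpow_0 [simp]: "vpow 0 = 1"
  by (simp add: vpow_def)

lemma vpow_mult: "vpow k * vpow l = vpow (k + l)"
  by (simp add: vpow_def mult_single)

lemma vpow_mult_assoc: "vpow k * (vpow l * p) = vpow (k + l) * p"
  by (simp add: vpow_mult mult.assoc[symmetric])

lemma vpow_neq_0 [simp]: "vpow k \<noteq> 0"
  by (simp add: vpow_def)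

lemma lookup_laurent_bar: "lookup (laurent_bar p) k = lookup p (- k)"
  by (simp add: laurent_bar_def Poly_Mapping.map_key.rep_eq)

lemma laurent_bar_add: "laurent_bar (p + q) = laurent_bar p + laurent_bar q"
  by (rule poly_mapping_eqI) (simp add: lookup_laurent_bar lookup_add)

lemma laurent_bar_diff: "laurent_bar (p - q) = laurent_bar p - laurent_bar q"
  by (rule poly_mapping_eqI) (simp add: lookup_laurent_bar lookup_minus)

lemma laurent_bar_vpow [simp]: "laurent_bar (vpow k) = vpow (- k)"
  by (rule poly_mapping_eqI) (auto simp: lookup_laurent_bar lookup_vpow when_def)

lemma laurent_bar_of_int [simp]: "laurent_bar (of_int k) = of_int k"
  by (rule poly_mapping_eqI) (auto simp: lookup_laurent_bar lookup_of_int when_def)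

lemma laurent_bar_1 [simp]: "laurent_bar 1 = 1"
  using laurent_bar_of_int[of 1] by simp

lemma laurent_bar_mult: "laurent_bar (p * q) = laurent_bar p * laurent_bar q"
proof (rule frag_induction[of p UNIV])
  show "laurent_bar (0 * q) = laurent_bar 0 * laurent_bar q"
    using laurent_bar_of_int[of 0] by simp
  show "laurent_bar (frag_of k * q) = laurent_bar (frag_of k) * laurent_bar q" for k
    unfolding vpow_def[symmetric] laurent_bar_vpow
    by (rule poly_mapping_eqI) (simp add: lookup_laurent_bar lookup_vpow_mult)
  show "laurent_bar ((p - p') * q) = laurent_bar (p - p') * laurent_bar q"
    if "laurent_bar (p * q) = laurent_bar p * laurent_bar q"
      "laurent_bar (p' * q) = laurent_bar p' * laurent_bar q" for p p'
    using that by (simp add: left_diff_distrib laurent_bar_diff)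
qed simp

definition quantum_two :: laurent where
  "quantum_two = vpow 1 + vpow (- 1)"

subsection \<open>The underlying module\<close>

lemma lookup_hscale [simp]: "lookup (hscale a h) w = a * lookup h w"
  by (auto simp: hscale_def Poly_Mapping.map.rep_eq when_def)

lemma lookup_T_basis: "lookup (T_basis w) y = (1 when y = w)"
  by (auto simp: T_basis_def lookup_single when_def)

interpretation hecke: module hscale
  by standard (auto intro!: poly_mapping_eqI simp: lookup_add algebra_simps)

lemma hecke_expansion: "h = (\<Sum>w\<in>keys h. hscale (lookup h w) (T_basis w))"
proof (rule poly_mapping_eqI)
  fix y
  have "lookup (\<Sum>w\<in>keys h. hscale (lookup h w) (T_basis w)) y =
      (\<Sum>w\<in>keys h. if w = y then lookup h w else 0)"
    unfolding lookup_sum by (intro sum.cong) (auto simp: lookup_T_basis when_def)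
  then show "lookup h y = lookup (\<Sum>w\<in>keys h. hscale (lookup h w) (T_basis w)) y"
    by (simp add: in_keys_iff)
qed

lemma span_T_basis: "hecke.span (range T_basis) = UNIV"
proof -
  have "h \<in> hecke.span (range T_basis)" for h
    by (subst hecke_expansion) (intro hecke.span_sum hecke.span_scale hecke.span_base rangeI)
  then show ?thesis by blast
qed

lemma module_hom_eqI_T_basis:
  assumes "module_hom hscale s F" "module_hom hscale s G" "\<And>w. F (T_basis w) = G (T_basis w)"
  shows "F h = G h"
proof -
  interpret module_pair hscale s
    using assms(1) by (simp add: module_pair_def module_hom_def)
  show ?thesis
    using module_hom_eq_on_span[OF assms(1,2), of "range T_basis"] assms(3) span_T_basis by auto
qed

definition is_ring_hom :: "('a::ring_1 \<Rightarrow> 'b::ring_1) \<Rightarrow> bool" where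
  "is_ring_hom \<phi> \<longleftrightarrow> \<phi> 1 = 1 \<and> (\<forall>a b. \<phi> (a + b) = \<phi> a + \<phi> b) \<and> (\<forall>a b. \<phi> (a * b) = \<phi> a * \<phi> b)"

lemma is_ring_hom_zero: "is_ring_hom \<phi> \<Longrightarrow> \<phi> 0 = 0"
  unfolding is_ring_hom_def by (metis add_cancel_right_right)

lemma is_ring_hom_ident: "is_ring_hom (\<lambda>c. c)"
  by (simp add: is_ring_hom_def)

lemma is_ring_hom_of_int: "is_ring_hom of_int"
  by (simp add: is_ring_hom_def)

lemma is_ring_hom_laurent_bar: "is_ring_hom laurent_bar"
  by (simp add: is_ring_hom_def laurent_bar_add laurent_bar_mult)

lemma module_twist:
  assumes "module s" "is_ring_hom \<phi>" shows "module (\<lambda>a. s (\<phi> a))"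
proof -
  interpret module s by fact
  show ?thesis
    using assms(2)
    by unfold_locales (simp_all add: is_ring_hom_def scale_left_distrib scale_right_distrib)
qed

lemma module_hom_twist:
  assumes "module_hom s1 s2 F" "is_ring_hom \<phi>"
  shows "module_hom (\<lambda>a. s1 (\<phi> a)) (\<lambda>a. s2 (\<phi> a)) F"
  using assms by (simp add: module_hom_iff module_twist)

abbreviation bar_scale :: "laurent \<Rightarrow> hecke \<Rightarrow> hecke" where
  "bar_scale a \<equiv> hscale (laurent_bar a)"

interpretation bar_hecke: module bar_scale
  using hecke.module_axioms is_ring_hom_laurent_bar by (rule module_twist)

definition linear_extension :: "(laurent \<Rightarrow> laurent) \<Rightarrow> (weyl \<Rightarrow> hecke) \<Rightarrow> hecke \<Rightarrow> hecke" where
  "linear_extension \<phi> F h = (\<Sum>w\<in>keys h. hscale (\<phi> (lookup h w)) (F w))"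

lemma linear_extension_superset:
  assumes "finite A" "keys h \<subseteq> A" "\<phi> 0 = 0"
  shows "linear_extension \<phi> F h = (\<Sum>w\<in>A. hscale (\<phi> (lookup h w)) (F w))"
  unfolding linear_extension_def using assms
  by (intro sum.mono_neutral_left) (auto simp: in_keys_iff)

lemma module_hom_linear_extension:
  assumes hom: "is_ring_hom \<phi>"
  shows "module_hom hscale (\<lambda>a. hscale (\<phi> a)) (linear_extension \<phi> F)"
  unfolding module_hom_iff
proof (intro conjI allI)
  show "module hscale" by (rule hecke.module_axioms)
  then show "module (\<lambda>a. hscale (\<phi> a))" using hom by (rule module_twist)
  fix h h' :: hecke and a
  have "keys (h + h') \<subseteq> keys h \<union> keys h'" by (rule keys_add)
  then show "linear_extension \<phi> F (h + h') = linear_extension \<phi> F h + linear_extension \<phi> F h'"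
    using linear_extension_superset[of "keys h \<union> keys h'" _ \<phi> F] hom is_ring_hom_zero[OF hom]
    by (simp add: is_ring_hom_def lookup_add hecke.scale_left_distrib sum.distrib)
  have "keys (hscale a h) \<subseteq> keys h" by (auto simp: in_keys_iff)
  then show "linear_extension \<phi> F (hscale a h) = hscale (\<phi> a) (linear_extension \<phi> F h)"
    using linear_extension_superset[of "keys h" _ \<phi> F] hom is_ring_hom_zero[OF hom]
    by (simp add: is_ring_hom_def hecke.scale_sum_right)
qed

lemma linear_extension_T_basis: "is_ring_hom \<phi> \<Longrightarrow> linear_extension \<phi> F (T_basis w) = F w"
  by (simp add: is_ring_hom_def linear_extension_def T_basis_def)

lemma obtain_longest_key:
  fixes h :: "weyl \<Rightarrow>\<^sub>0 'b::zero"
  assumes "h \<noteq> 0"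
  obtains y where "y \<in> keys h" "\<And>w. w \<in> keys h \<Longrightarrow> len w \<le> len y"
proof -
  have "keys h \<noteq> {}" using assms poly_mapping_eqI[of h 0] by (auto simp: in_keys_iff)
  then obtain y where "y \<in> keys h" "len y = Max (len ` keys h)"
    using obtains_MAX[of "keys h" len] by (metis finite_keys)
  then show thesis using that[of y] by simp
qed

lemma lookup_linear_extension_longest:
  assumes "y \<in> keys h" "\<And>w. w \<in> keys h \<Longrightarrow> len w \<le> len y" "is_ring_hom \<phi>"
    and triangular: "\<And>w. len w \<le> len y \<Longrightarrow> w \<noteq> y \<Longrightarrow> lookup (F w) y = 0"
  shows "lookup (linear_extension \<phi> F h) y = \<phi> (lookup h y) * lookup (F y) y"
proof -
  have "lookup (linear_extension \<phi> F h) y =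
      (\<Sum>w\<in>keys h. if w = y then \<phi> (lookup h y) * lookup (F y) y else 0)"
    unfolding linear_extension_def lookup_sum
    by (intro sum.cong) (use assms(2) triangular in auto)
  then show ?thesis using assms(1) by simp
qed

subsection \<open>Multiplication by the generators\<close>

definition T_simple_image :: "gen \<Rightarrow> weyl \<Rightarrow> hecke" where
  "T_simple_image a w = (if len w < len (simple a * w) then T_basis (simple a * w)
      else hscale (vpow 2) (T_basis (simple a * w)) + hscale (vpow 2 - 1) (T_basis w))"

lemma T_simple_mult_eq_linear_extension:
  "T_simple_mult a = linear_extension (\<lambda>c. c) (T_simple_image a)"
  by (rule ext) (simp add: T_simple_mult_def linear_extension_def T_simple_image_def)

interpretation T_simple_mult: module_hom hscale hscale "T_simple_mult a" for a
  unfolding T_simple_mult_eq_linear_extension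
  by (rule module_hom_linear_extension[OF is_ring_hom_ident])

lemma T_simple_mult_T_basis: "T_simple_mult a (T_basis w) = T_simple_image a w"
  unfolding T_simple_mult_eq_linear_extension
  by (rule linear_extension_T_basis[OF is_ring_hom_ident])

lemma T_simple_mult_ascent: "a \<notin> descents w \<Longrightarrow> T_simple_mult a (T_basis w) = T_basis (simple a * w)"
  by (simp add: T_simple_mult_T_basis T_simple_image_def len_ascent)

lemma T_simple_mult_descent:
  "a \<in> descents w \<Longrightarrow> T_simple_mult a (T_basis w) =
     hscale (vpow 2) (T_basis (simple a * w)) + hscale (vpow 2 - 1) (T_basis w)"
  by (simp add: T_simple_mult_T_basis T_simple_image_def descents_iff)

lemma T_basis_simple: "T_basis (simple a) = T_simple_mult a (T_basis 1)"
  by (simp add: T_simple_mult_ascent)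

lemma lookup_T_simple_mult:
  "lookup (T_simple_mult a h) y =
     (if a \<in> descents y then lookup h (simple a * y) + (vpow 2 - 1) * lookup h y
      else vpow 2 * lookup h (simple a * y))"
proof -
  let ?term = "\<lambda>w. lookup h w * lookup (T_simple_image a w) y"
  have "lookup (T_simple_mult a h) y = (\<Sum>w\<in>keys h. ?term w)"
    by (simp add: T_simple_mult_eq_linear_extension linear_extension_def lookup_sum)
  also have "\<dots> = (\<Sum>w\<in>{simple a * y, y}. ?term w)"
  proof (rule sum.mono_neutral_cong)
    fix w assume "w \<in> keys h - {simple a * y, y}"
    then have "w \<noteq> y" "y \<noteq> simple a * w" by auto
    then show "?term w = 0" by (simp add: T_simple_image_def lookup_T_basis lookup_add)
  qed (auto simp: in_keys_iff)
  also have "\<dots> = (if a \<in> descents y then lookup h (simple a * y) + (vpow 2 - 1) * lookup h y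
      else vpow 2 * lookup h (simple a * y))"
    using len_descent[of a y] len_ascent[of a y]
    by (simp add: T_simple_image_def lookup_T_basis lookup_add mult.commute)
  finally show ?thesis .
qed

lemma T_simple_mult_square:
  "T_simple_mult a (T_simple_mult a h) =
      hscale (vpow 2) h + hscale (vpow 2 - 1) (T_simple_mult a h)"
  by (rule poly_mapping_eqI) (simp add: lookup_T_simple_mult lookup_add lookup_minus algebra_simps)

definition hinv :: "hecke \<Rightarrow> hecke" where
  "hinv h = Poly_Mapping.map_key winv h"

lemma lookup_hinv [simp]: "lookup (hinv h) w = lookup h (winv w)"
proof -
  have "inj winv" by (simp add: inj_def)
  then show ?thesis by (simp add: hinv_def Poly_Mapping.map_key.rep_eq)
qed

lemma hinv_hinv [simp]: "hinv (hinv h) = h"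
  by (rule poly_mapping_eqI) simp

interpretation hinv: module_hom hscale hscale hinv
  by standard (auto intro!: poly_mapping_eqI simp: lookup_add)

lemma hinv_T_basis [simp]: "hinv (T_basis w) = T_basis (winv w)"
  by (rule poly_mapping_eqI) (auto simp: lookup_T_basis when_def)

definition T_mult_simple :: "gen \<Rightarrow> hecke \<Rightarrow> hecke" where
  "T_mult_simple a h = hinv (T_simple_mult a (hinv h))"

interpretation T_mult_simple: module_hom hscale hscale "T_mult_simple a" for a
  by standard
    (simp_all add: T_mult_simple_def hinv.add hinv.scale T_simple_mult.add T_simple_mult.scale)

lemma lookup_T_mult_simple:
  "lookup (T_mult_simple a h) y =
     (if a \<in> right_descents y then lookup h (y * simple a) + (vpow 2 - 1) * lookup h y
      else vpow 2 * lookup h (y * simple a))"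
  by (simp add: T_mult_simple_def lookup_T_simple_mult winv_mult)

lemma T_mult_simple_ascent:
  "a \<notin> right_descents w \<Longrightarrow> T_mult_simple a (T_basis w) = T_basis (w * simple a)"
  by (simp add: T_mult_simple_def T_simple_mult_ascent winv_mult)

lemma T_simple_mult_T_mult_simple:
  "T_simple_mult a (T_mult_simple b h) = T_mult_simple b (T_simple_mult a h)"
proof (rule poly_mapping_eqI)
  fix w
  show "lookup (T_simple_mult a (T_mult_simple b h)) w =
      lookup (T_mult_simple b (T_simple_mult a h)) w"
  proof (cases "simple a * w = w * simple b")
    case False
    then have "a \<in> descents (w * simple b) \<longleftrightarrow> a \<in> descents w"
      "b \<in> right_descents (simple a * w) \<longleftrightarrow> b \<in> right_descents w"
      by (simp_all add: descents_mult_simple right_descents_simple_mult)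
    then show ?thesis
      by (auto simp: lookup_T_simple_mult lookup_T_mult_simple mult.assoc algebra_simps)
  next
    case True
    then have "a \<in> descents w \<longleftrightarrow> b \<in> right_descents w" "simple a * (w * simple b) = w"
      by (simp_all add: descents_def right_descents_def flip: True)
    moreover have "a \<in> descents (w * simple b) \<longleftrightarrow> a \<notin> descents w"
      "b \<in> right_descents (w * simple b) \<longleftrightarrow> b \<notin> right_descents w"
      using True by (simp_all add: descents_mult_simple)
    ultimately show ?thesis
      using True by (auto simp: lookup_T_simple_mult lookup_T_mult_simple mult.assoc algebra_simps)
  qed
qed

lemma right_module_map_eqI:
  assumes F: "module_hom hscale hscale F" "\<And>a h. F (T_mult_simple a h) = T_mult_simple a (F h)"
    and G: "module_hom hscale hscale G" "\<And>a h. G (T_mult_simple a h) = T_mult_simple a (G h)"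
    and at_one: "F (T_basis 1) = G (T_basis 1)"
  shows "F h = G h"
proof (rule module_hom_eqI_T_basis[OF F(1) G(1)])
  have "F (T_basis (winv w)) = G (T_basis (winv w))" for w
  proof (induction w rule: ascent_induct)
    case (ascent a w)
    then have "T_basis (winv (simple a * w)) = T_mult_simple a (T_basis (winv w))"
      by (simp add: T_mult_simple_ascent winv_mult)
    then show ?case using F(2) G(2) ascent.IH by metis
  qed (simp add: at_one)
  then show "F (T_basis w) = G (T_basis w)" for w
    by (metis weyl_group.inverse_inverse)
qed

subsection \<open>The product\<close>

lemma reduced_word: "reduced (reduced_word w)" "word (reduced_word w) = w"
proof -
  have "\<exists>xs. reduced xs \<and> word xs = w" using ex_reduced[of w] by (auto simp: reduced_def)
  then have "reduced (reduced_word w) \<and> word (reduced_word w) = w"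
    unfolding reduced_word_def by (rule someI_ex)
  then show "reduced (reduced_word w)" "word (reduced_word w) = w" by auto
qed

interpretation foldr_T_simple_mult: module_hom hscale hscale "foldr T_simple_mult xs" for xs
proof (induction xs)
  case (Cons a xs)
  from module_hom_compose[OF this T_simple_mult.module_hom_axioms] show ?case
    by (simp add: comp_def)
qed (simp add: module_hom_iff hecke.module_axioms)

lemma foldr_T_mult_simple:
  "foldr T_simple_mult xs (T_mult_simple a h) = T_mult_simple a (foldr T_simple_mult xs h)"
  by (induction xs) (simp_all add: T_simple_mult_T_mult_simple)

lemma foldr_T_basis_1: "reduced xs \<Longrightarrow> foldr T_simple_mult xs (T_basis 1) = T_basis (word xs)"
proof (induction xs)
  case (Cons a xs)
  have "len (word (a # xs)) \<le> len (word xs) + 1"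
    using len_mult_le[of "simple a" "word xs"] word_Cons[of a xs] by simp
  then have "reduced xs" "len (simple a * word xs) = len (word xs) + 1"
    using Cons.prems len_word_le[of xs] word_Cons[of a xs] by (simp_all add: reduced_def)
  then show ?case using Cons.IH T_simple_mult_ascent[of a "word xs"] word_Cons[of a xs]
    by (simp add: descents_iff)
qed (simp add: word_Nil)

interpretation hmult_left: module_hom hscale hscale "\<lambda>h. hmult h h'" for h'
proof -
  have "(\<lambda>h. hmult h h') = linear_extension (\<lambda>c. c) (\<lambda>x. foldr T_simple_mult (reduced_word x) h')"
    by (rule ext) (simp add: hmult_def linear_extension_def)
  then show "module_hom hscale hscale (\<lambda>h. hmult h h')"
    using module_hom_linear_extension[OF is_ring_hom_ident] by simp
qed

interpretation hmult_right: module_hom hscale hscale "hmult h" for h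
  by standard
    (simp_all add: hmult_def foldr_T_simple_mult.add foldr_T_simple_mult.scale
      hecke.scale_right_distrib
      sum.distrib hecke.scale_sum_right mult.commute)

lemma hmult_1_right [simp]: "hmult h (T_basis 1) = h"
  by (simp add: hmult_def foldr_T_basis_1 reduced_word hecke_expansion[symmetric])

lemma hmult_T_mult_simple: "hmult h (T_mult_simple a h') = T_mult_simple a (hmult h h')"
  by (simp add: hmult_def foldr_T_mult_simple T_mult_simple.sum T_mult_simple.scale)

lemma hmult_1_left [simp]: "hmult (T_basis 1) h = h"
  by (rule right_module_map_eqI[OF hmult_right.module_hom_axioms hmult_T_mult_simple])
    (simp_all add: hecke.module_hom_ident)

lemma T_simple_mult_hmult: "T_simple_mult a (hmult h h') = hmult (T_simple_mult a h) h'"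
proof (rule right_module_map_eqI[OF _ _ hmult_right.module_hom_axioms hmult_T_mult_simple])
  show "module_hom hscale hscale (\<lambda>h'. T_simple_mult a (hmult h h'))"
    using module_hom_compose[OF hmult_right.module_hom_axioms T_simple_mult.module_hom_axioms]
    by (simp add: comp_def)
qed (simp_all add: hmult_T_mult_simple T_simple_mult_T_mult_simple)

lemma hmult_assoc: "hmult (hmult h1 h2) h3 = hmult h1 (hmult h2 h3)"
proof (rule right_module_map_eqI[OF hmult_right.module_hom_axioms hmult_T_mult_simple])
  show "module_hom hscale hscale (\<lambda>h3. hmult h1 (hmult h2 h3))"
    using module_hom_compose[OF hmult_right.module_hom_axioms hmult_right.module_hom_axioms]
    by (simp add: comp_def)
qed (simp_all add: hmult_T_mult_simple)

lemma hmult_T_simple: "hmult (T_basis (simple a)) h = T_simple_mult a h"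
  by (simp add: T_basis_simple T_simple_mult_hmult[symmetric])

lemma hinv_hmult: "hinv (hmult g h) = hmult (hinv h) (hinv g)"
proof -
  have "hmult g h = hinv (hmult (hinv h) (hinv g))"
  proof (rule right_module_map_eqI[OF hmult_right.module_hom_axioms hmult_T_mult_simple])
    show "module_hom hscale hscale (\<lambda>h. hinv (hmult (hinv h) (hinv g)))"
      by standard (simp_all add: hinv.add hinv.scale hmult_left.add hmult_left.scale)
  qed (simp_all add: T_mult_simple_def T_simple_mult_hmult)
  then show ?thesis by simp
qed

subsection \<open>The bar involution\<close>

definition T_simple_mult_inv :: "gen \<Rightarrow> hecke \<Rightarrow> hecke" where
  "T_simple_mult_inv a h = hscale (vpow (- 2)) (T_simple_mult a h) + hscale (vpow (- 2) - 1) h"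

interpretation T_simple_mult_inv: module_hom hscale hscale "T_simple_mult_inv a" for a
  by standard
    (simp_all add: T_simple_mult_inv_def T_simple_mult.add T_simple_mult.scale
      hecke.scale_right_distrib mult.commute)

lemma T_simple_mult_inv_right [simp]: "T_simple_mult a (T_simple_mult_inv a h) = h"
  unfolding T_simple_mult_inv_def T_simple_mult.add T_simple_mult.scale T_simple_mult_square
  by (rule poly_mapping_eqI) (simp add: lookup_add algebra_simps vpow_mult vpow_mult_assoc)

lemma T_simple_mult_inv_left [simp]: "T_simple_mult_inv a (T_simple_mult a h) = h"
  unfolding T_simple_mult_inv_def T_simple_mult_square
  by (rule poly_mapping_eqI) (simp add: lookup_add algebra_simps vpow_mult vpow_mult_assoc)

lemma T_simple_mult_inv_hmult: "T_simple_mult_inv a (hmult h h') = hmult (T_simple_mult_inv a h) h'"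
  by (simp add: T_simple_mult_inv_def T_simple_mult_hmult hmult_left.add hmult_left.scale)

definition inverse_pair :: "hecke \<Rightarrow> hecke \<Rightarrow> bool" where
  "inverse_pair h h' \<longleftrightarrow> hmult h h' = T_basis 1 \<and> hmult h' h = T_basis 1"

lemma inverse_pair_one: "inverse_pair (T_basis 1) (T_basis 1)"
  by (simp add: inverse_pair_def)

lemma inverse_pair_unique: "inverse_pair h g \<Longrightarrow> inverse_pair h' g \<Longrightarrow> h = h'"
  unfolding inverse_pair_def by (metis hmult_assoc hmult_1_left hmult_1_right)

lemma T_inverse_eqI: "inverse_pair h (T_basis w) \<Longrightarrow> T_inverse w = h"
  unfolding T_inverse_def
  by (rule the_equality) (auto simp: inverse_pair_def[symmetric] intro: inverse_pair_unique)

lemma inverse_pair_T_basis_ascent: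
  assumes h: "inverse_pair h (T_basis (winv w))" and a: "a \<notin> descents w"
  shows "inverse_pair (T_simple_mult_inv a h) (T_basis (winv (simple a * w)))"
proof -
  have "T_basis (winv (simple a * w)) = hinv (hmult (T_basis (simple a)) (T_basis w))"
    using a by (simp add: hmult_T_simple T_simple_mult_ascent)
  also have "\<dots> = hmult (T_basis (winv w)) (T_basis (simple a))"
    by (simp add: hinv_hmult)
  finally have factor: "T_basis (winv (simple a * w)) =
      hmult (T_basis (winv w)) (T_basis (simple a))" .
  have "hmult h (T_basis (winv (simple a * w))) = T_basis (simple a)"
    using h unfolding factor by (simp add: inverse_pair_def hmult_assoc[symmetric])
  then have "hmult (T_simple_mult_inv a h) (T_basis (winv (simple a * w))) = T_basis 1"
    by (simp add: T_simple_mult_inv_hmult[symmetric] T_basis_simple)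
  moreover have "hmult (T_basis (winv (simple a * w))) (T_simple_mult_inv a h) = T_basis 1"
    using h unfolding factor by (simp add: inverse_pair_def hmult_assoc hmult_T_simple)
  ultimately show ?thesis by (simp add: inverse_pair_def)
qed

lemma inverse_pair_T_inverse: "inverse_pair (T_inverse (winv w)) (T_basis (winv w))"
proof (induction w rule: ascent_induct)
  case one
  show ?case using T_inverse_eqI[OF inverse_pair_one] inverse_pair_one by simp
next
  case (ascent a w)
  then have "inverse_pair (T_simple_mult_inv a (T_inverse (winv w)))
      (T_basis (winv (simple a * w)))"
    by (intro inverse_pair_T_basis_ascent)
  then show ?case using T_inverse_eqI by auto
qed

interpretation hecke_bar: module_hom hscale bar_scale hecke_bar
proof -
  have extension: "hecke_bar = linear_extension laurent_bar (\<lambda>w. T_inverse (winv w))"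
    by (rule ext) (simp add: hecke_bar_def linear_extension_def)
  show "module_hom hscale bar_scale hecke_bar"
    unfolding extension by (rule module_hom_linear_extension[OF is_ring_hom_laurent_bar])
qed

lemma hecke_bar_T_basis: "hecke_bar (T_basis w) = T_inverse (winv w)"
  by (simp add: hecke_bar_def T_basis_def)

lemma hecke_bar_T_basis_1 [simp]: "hecke_bar (T_basis 1) = T_basis 1"
  by (simp add: hecke_bar_T_basis T_inverse_eqI inverse_pair_one)

lemma hecke_bar_T_basis_ascent:
  "a \<notin> descents w \<Longrightarrow>
     hecke_bar (T_basis (simple a * w)) = T_simple_mult_inv a (hecke_bar (T_basis w))"
  unfolding hecke_bar_T_basis
  by (rule T_inverse_eqI) (rule inverse_pair_T_basis_ascent[OF inverse_pair_T_inverse])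

lemma hecke_bar_T_simple_mult: "hecke_bar (T_simple_mult a h) = T_simple_mult_inv a (hecke_bar h)"
proof (rule module_hom_eqI_T_basis[of bar_scale "\<lambda>h. hecke_bar (T_simple_mult a h)"
      "\<lambda>h. T_simple_mult_inv a (hecke_bar h)"])
  show "module_hom hscale bar_scale (\<lambda>h. hecke_bar (T_simple_mult a h))"
    by standard (simp_all add: T_simple_mult.add T_simple_mult.scale hecke_bar.add hecke_bar.scale)
  show "module_hom hscale bar_scale (\<lambda>h. T_simple_mult_inv a (hecke_bar h))"
    by standard
      (simp_all add: T_simple_mult_inv.add T_simple_mult_inv.scale hecke_bar.add hecke_bar.scale)
  show "hecke_bar (T_simple_mult a (T_basis w)) = T_simple_mult_inv a (hecke_bar (T_basis w))" for w
  proof (cases "a \<in> descents w")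
    case False
    then show ?thesis by (simp add: T_simple_mult_ascent hecke_bar_T_basis_ascent)
  next
    case True
    then have "hecke_bar (T_basis w) = T_simple_mult_inv a (hecke_bar (T_basis (simple a * w)))"
      using hecke_bar_T_basis_ascent[of a "simple a * w"] by simp
    then have "hecke_bar (T_basis (simple a * w)) = T_simple_mult a (hecke_bar (T_basis w))"
      by simp
    then show ?thesis
      using T_simple_mult_descent[OF True]
      by (simp add: hecke_bar.add hecke_bar.scale T_simple_mult_inv_def laurent_bar_diff)
  qed
qed

lemma hecke_bar_hinv: "hecke_bar (hinv h) = hinv (hecke_bar h)"
proof (rule module_hom_eqI_T_basis[of bar_scale "\<lambda>h. hecke_bar (hinv h)" "\<lambda>h. hinv (hecke_bar h)"])
  show "module_hom hscale bar_scale (\<lambda>h. hecke_bar (hinv h))"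
    by standard (simp_all add: hinv.add hinv.scale hecke_bar.add hecke_bar.scale)
  show "module_hom hscale bar_scale (\<lambda>h. hinv (hecke_bar h))"
    by standard (simp_all add: hinv.add hinv.scale hecke_bar.add hecke_bar.scale)
  have "inverse_pair (hinv (T_inverse (winv w))) (hinv (T_basis (winv w)))" for w
    using inverse_pair_T_inverse[of w] unfolding inverse_pair_def hinv_hmult[symmetric] by simp
  then show "hecke_bar (hinv (T_basis w)) = hinv (hecke_bar (T_basis w))" for w
    by (simp add: hecke_bar_T_basis T_inverse_eqI)
qed

lemma lookup_hecke_bar_T_basis:
  "len w \<le> len y \<Longrightarrow> lookup (hecke_bar (T_basis w)) y = (vpow (- 2 * int (len w)) when y = w)"
proof (induction w arbitrary: y rule: ascent_induct)
  case one
  then show ?case by (simp add: lookup_T_basis)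
next
  case (ascent a x)
  let ?h = "hecke_bar (T_basis x)"
  have len_ax: "len (simple a * x) = len x + 1" using ascent.hyps by (rule len_ascent)
  then have "lookup ?h y = 0" using ascent.IH[of y] ascent.prems by (auto simp: when_def)
  then have step: "lookup (hecke_bar (T_basis (simple a * x))) y =
      vpow (- 2) * (if a \<in> descents y then lookup ?h (simple a * y)
        else vpow 2 * lookup ?h (simple a * y))"
    using ascent.hyps
    by (simp add: hecke_bar_T_basis_ascent T_simple_mult_inv_def lookup_add lookup_T_simple_mult)
  have "lookup ?h (simple a * y) = (vpow (- 2 * int (len x)) when simple a * y = x)"
    using len_simple_mult[of a y] ascent.prems len_ax by (intro ascent.IH) linarith
  moreover have "vpow (- 2) * vpow (- 2 * int (len x)) = vpow (- 2 * int (len (simple a * x)))"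
    by (simp add: len_ax vpow_mult)
  moreover have "simple a * y = x \<longleftrightarrow> y = simple a * x" by auto
  ultimately show ?case
    using ascent.hyps unfolding step by (auto simp: when_def)
qed

subsection \<open>Coordinates in the normalised basis\<close>

text \<open>The normalised basis consists of the elements \<open>v\<^sup>-\<^sup>l\<^sup>(\<^sup>y\<^sup>) T\<^sub>y\<close>.\<close>

definition ncoeff :: "hecke \<Rightarrow> weyl \<Rightarrow> laurent" where
  "ncoeff h y = vpow (int (len y)) * lookup h y"

lemma ncoeff_add: "ncoeff (h + h') y = ncoeff h y + ncoeff h' y"
  by (simp add: ncoeff_def lookup_add distrib_left)

lemma ncoeff_diff: "ncoeff (h - h') y = ncoeff h y - ncoeff h' y"
  by (simp add: ncoeff_def lookup_minus right_diff_distrib)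

lemma ncoeff_scale: "ncoeff (hscale a h) y = a * ncoeff h y"
  by (simp add: ncoeff_def mult.left_commute)

lemma ncoeff_sum: "ncoeff (sum f A) y = (\<Sum>x\<in>A. ncoeff (f x) y)"
  by (simp add: ncoeff_def lookup_sum sum_distrib_left)

lemma lookup_eq_ncoeff: "lookup h y = vpow (- int (len y)) * ncoeff h y"
  by (simp add: ncoeff_def vpow_mult_assoc)

lemma ncoeff_eqI: "(\<And>y. ncoeff h y = ncoeff h' y) \<Longrightarrow> h = h'"
  by (rule poly_mapping_eqI) (simp add: lookup_eq_ncoeff)

lemma ncoeff_T_basis_1: "ncoeff (T_basis 1) y = (1 when y = 1)"
  by (simp add: ncoeff_def lookup_T_basis when_def)

lemma ncoeff_hinv: "ncoeff (hinv h) y = ncoeff h (winv y)"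
  by (simp add: ncoeff_def)

definition C_simple_mult :: "gen \<Rightarrow> hecke \<Rightarrow> hecke" where
  "C_simple_mult a h = hscale (vpow (- 1)) (T_simple_mult a h + h)"

interpretation C_simple_mult: module_hom hscale hscale "C_simple_mult a" for a
  by standard
    (simp_all add: C_simple_mult_def T_simple_mult.add T_simple_mult.scale hecke.scale_right_distrib
      mult.commute)

lemma ncoeff_C_simple_mult:
  "ncoeff (C_simple_mult a h) y =
     ncoeff h (simple a * y) + vpow (if a \<in> descents y then 1 else - 1) * ncoeff h y"
  using len_descent[of a y] len_ascent[of a y]
  by (simp add: ncoeff_def C_simple_mult_def lookup_T_simple_mult lookup_add vpow_mult_assoc
      distrib_left left_diff_distrib right_diff_distrib add.commute)

lemma C_simple_mult_hmult: "C_simple_mult a (hmult h h') = hmult (C_simple_mult a h) h'"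
  by (simp add: C_simple_mult_def T_simple_mult_hmult hmult_left.add hmult_left.scale)

lemma hecke_bar_C_simple_mult: "hecke_bar (C_simple_mult a h) = C_simple_mult a (hecke_bar h)"
  unfolding C_simple_mult_def hecke_bar.scale hecke_bar.add hecke_bar_T_simple_mult
    T_simple_mult_inv_def
  by (rule poly_mapping_eqI)
    (simp add: lookup_add vpow_mult_assoc distrib_left left_diff_distrib right_diff_distrib)

lemma C_simple_mult_square:
  "C_simple_mult a (C_simple_mult a h) = hscale quantum_two (C_simple_mult a h)"
  unfolding C_simple_mult_def T_simple_mult.scale T_simple_mult.add T_simple_mult_square
    quantum_two_def
  by (rule poly_mapping_eqI)
    (simp add: lookup_add vpow_mult vpow_mult_assoc distrib_left distrib_right left_diff_distrib
      right_diff_distrib)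

section \<open>The Kazhdan--Lusztig basis\<close>

subsection \<open>Two conditions on Laurent polynomials\<close>

definition strictly_negative :: "laurent \<Rightarrow> bool" where
  "strictly_negative p \<longleftrightarrow> (\<forall>k\<ge>0. lookup p k = 0)"

lemma strictly_negative_0 [simp]: "strictly_negative 0"
  by (simp add: strictly_negative_def)

lemma strictly_negative_add: "strictly_negative p \<Longrightarrow> strictly_negative q \<Longrightarrow> strictly_negative (p + q)"
  by (simp add: strictly_negative_def lookup_add)

lemma strictly_negative_diff:
  "strictly_negative p \<Longrightarrow> strictly_negative q \<Longrightarrow> strictly_negative (p - q)"
  by (simp add: strictly_negative_def lookup_minus)

lemma strictly_negative_of_int_mult: "strictly_negative p \<Longrightarrow> strictly_negative (of_int n * p)"
  by (simp add: strictly_negative_def lookup_of_int_mult)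

lemma strictly_negative_sum: "(\<And>x. x \<in> A \<Longrightarrow> strictly_negative (f x)) \<Longrightarrow> strictly_negative (sum f A)"
  by (simp add: strictly_negative_def lookup_sum)

lemma strictly_negative_vpow_minus_one_mult:
  "strictly_negative p \<or> p = 1 \<Longrightarrow> strictly_negative (vpow (- 1) * p)"
  by (auto simp: strictly_negative_def lookup_vpow_mult lookup_one when_def)

lemma strictly_negative_vpow_one_mult_diff:
  "strictly_negative p \<Longrightarrow> strictly_negative (vpow 1 * p - of_int (lookup p (- 1)))"
  by (simp add: strictly_negative_def lookup_minus lookup_vpow_mult lookup_of_int when_def)

lemma strictly_negative_bar_invariant_eq_0:
  assumes "strictly_negative p" "laurent_bar p = p" shows "p = 0"
proof (rule poly_mapping_eqI)
  fix k
  have "lookup p k = lookup p (- k)" using lookup_laurent_bar[of p k] assms(2) by simp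
  then show "lookup p k = lookup 0 k"
    using assms(1) by (cases "k \<ge> 0") (auto simp: strictly_negative_def)
qed

definition q_polynomial :: "laurent \<Rightarrow> bool" where
  "q_polynomial p \<longleftrightarrow> (\<forall>k. lookup p k \<noteq> 0 \<longrightarrow> 0 \<le> k \<and> even k)"

lemma q_polynomial_0 [simp]: "q_polynomial 0"
  by (simp add: q_polynomial_def)

lemma q_polynomial_add: "q_polynomial p \<Longrightarrow> q_polynomial q \<Longrightarrow> q_polynomial (p + q)"
  unfolding q_polynomial_def lookup_add by (metis add_0)

lemma q_polynomial_diff: "q_polynomial p \<Longrightarrow> q_polynomial q \<Longrightarrow> q_polynomial (p - q)"
  unfolding q_polynomial_def lookup_minus by (metis diff_self)

lemma q_polynomial_sum: "(\<And>x. x \<in> A \<Longrightarrow> q_polynomial (f x)) \<Longrightarrow> q_polynomial (sum f A)"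
  by (induction A rule: infinite_finite_induct) (simp_all add: q_polynomial_add)

lemma q_polynomial_of_int_mult: "q_polynomial p \<Longrightarrow> q_polynomial (of_int n * p)"
  by (simp add: q_polynomial_def lookup_of_int_mult)

lemma q_polynomial_shift:
  assumes "q_polynomial (vpow k * p)" "k \<le> l" "even (l - k)"
  shows "q_polynomial (vpow l * p)"
  unfolding q_polynomial_def lookup_vpow_mult
proof (intro allI impI)
  fix n assume "lookup p (n - l) \<noteq> 0"
  then have "lookup (vpow k * p) (n - (l - k)) \<noteq> 0" by (simp add: lookup_vpow_mult)
  then have "0 \<le> n - (l - k) \<and> even (n - (l - k))"
    using assms(1) unfolding q_polynomial_def by blast
  then show "0 \<le> n \<and> even n" using assms(2,3) by simp
qed

lemma lookup_poly_in_q: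
  "lookup (poly_in_q p) k = (if 0 \<le> k \<and> even k then coeff p (nat (k div 2)) else 0)"
proof -
  have "lookup (poly_in_q p) k = (\<Sum>i\<le>degree p. if 2 * int i = k then coeff p i else 0)"
    unfolding poly_in_q_def lookup_sum by (intro sum.cong) (auto simp: lookup_single when_def)
  also have "\<dots> = (if 0 \<le> k \<and> even k then coeff p (nat (k div 2)) else 0)"
  proof (cases "0 \<le> k \<and> even k")
    case True
    then have index: "2 * int i = k \<longleftrightarrow> i = nat (k div 2)" for i by auto
    show ?thesis using True unfolding index by (simp add: coeff_eq_0)
  next
    case False
    then have "2 * int i \<noteq> k" for i by auto
    then show ?thesis using False by auto
  qed
  finally show ?thesis .
qed

lemma poly_in_q_0 [simp]: "poly_in_q 0 = 0"
  by (simp add: poly_in_q_def)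

lemma poly_in_q_1 [simp]: "poly_in_q 1 = 1"
  by (simp add: poly_in_q_def)

lemma poly_in_q_eq_iff [simp]: "poly_in_q p = poly_in_q r \<longleftrightarrow> p = r"
proof
  assume eq: "poly_in_q p = poly_in_q r"
  show "p = r"
  proof (rule poly_eqI)
    fix n
    have "lookup (poly_in_q p) (2 * int n) = lookup (poly_in_q r) (2 * int n)" using eq by simp
    then show "coeff p n = coeff r n" by (simp add: lookup_poly_in_q)
  qed
qed simp

lemma q_polynomial_iff: "q_polynomial p \<longleftrightarrow> p \<in> range poly_in_q"
proof
  assume p: "q_polynomial p"
  have "inj (\<lambda>n. 2 * int n)" by (simp add: inj_def)
  then have "finite {n. lookup p (2 * int n) \<noteq> 0}"
    using finite_vimageI[of "keys p" "\<lambda>n. 2 * int n"] by (simp add: in_keys_iff vimage_def)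
  then have "coeff (Abs_poly (\<lambda>n. lookup p (2 * int n))) = (\<lambda>n. lookup p (2 * int n))"
    by (intro Abs_poly_inverse) (simp add: MOST_iff_cofinite)
  then have "p = poly_in_q (Abs_poly (\<lambda>n. lookup p (2 * int n)))"
    using p by (intro poly_mapping_eqI) (auto simp: lookup_poly_in_q q_polynomial_def)
  then show "p \<in> range poly_in_q" by blast
qed (auto simp: q_polynomial_def lookup_poly_in_q split: if_splits)

lemma strictly_negative_vpow_mult_poly_in_q:
  assumes "p \<noteq> 0"
  shows "strictly_negative (vpow (- n) * poly_in_q p) \<longleftrightarrow> 2 * int (degree p) < n"
proof
  assume negative: "strictly_negative (vpow (- n) * poly_in_q p)"
  have "lookup (vpow (- n) * poly_in_q p) (2 * int (degree p) - n) = lead_coeff p"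
    by (simp add: lookup_vpow_mult lookup_poly_in_q)
  then have "\<not> 0 \<le> 2 * int (degree p) - n"
    using assms negative by (metis leading_coeff_0_iff strictly_negative_def)
  then show "2 * int (degree p) < n" by simp
next
  assume degree: "2 * int (degree p) < n"
  have "coeff p (nat ((k + n) div 2)) = 0" if nonneg: "0 \<le> k" and even: "even (k + n)" for k
  proof -
    obtain m where "k + n = 2 * m" using even by (rule evenE)
    then show ?thesis using degree nonneg by (intro coeff_eq_0) simp
  qed
  then show "strictly_negative (vpow (- n) * poly_in_q p)"
    by (simp add: strictly_negative_def lookup_vpow_mult lookup_poly_in_q)
qed

subsection \<open>Uniqueness and existence of the basis\<close>

lemma bar_invariant_strictly_negative_eq_0:
  assumes bar: "hecke_bar h = h" and negative: "\<And>y. strictly_negative (ncoeff h y)"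
  shows "h = 0"
proof (rule ccontr)
  assume "h \<noteq> 0"
  then obtain y where y: "y \<in> keys h" "\<And>w. w \<in> keys h \<Longrightarrow> len w \<le> len y"
    using obtain_longest_key by blast
  have "hecke_bar h = linear_extension laurent_bar (\<lambda>w. hecke_bar (T_basis w)) h"
    unfolding hecke_bar_T_basis by (simp add: hecke_bar_def linear_extension_def)
  then have "lookup h y = laurent_bar (lookup h y) * vpow (- 2 * int (len y))"
    using bar
      lookup_linear_extension_longest[OF y is_ring_hom_laurent_bar, of "\<lambda>w. hecke_bar (T_basis w)"]
    by (simp add: lookup_hecke_bar_T_basis)
  then have "ncoeff h y =
      vpow (int (len y)) * (vpow (- 2 * int (len y)) * laurent_bar (lookup h y))"
    by (simp add: ncoeff_def mult.commute)
  also have "\<dots> = laurent_bar (ncoeff h y)"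
    by (simp add: ncoeff_def laurent_bar_mult vpow_mult_assoc)
  finally have "ncoeff h y = 0"
    using strictly_negative_bar_invariant_eq_0[OF negative] by metis
  with y(1) show False by (simp add: lookup_eq_ncoeff in_keys_iff)
qed

definition is_kl_element :: "weyl \<Rightarrow> hecke \<Rightarrow> bool" where
  "is_kl_element w C \<longleftrightarrow> hecke_bar C = C \<and> ncoeff C w = 1 \<and>
     (\<forall>y. ncoeff C y \<noteq> 0 \<longrightarrow> bruhat_le y w) \<and>
     (\<forall>y. y \<noteq> w \<longrightarrow> strictly_negative (ncoeff C y)) \<and>
     (\<forall>y. q_polynomial (vpow (int (len w) - int (len y)) * ncoeff C y))"

lemma is_kl_elementD:
  assumes "is_kl_element w C"
  shows "hecke_bar C = C" "ncoeff C w = 1" "ncoeff C y \<noteq> 0 \<Longrightarrow> bruhat_le y w"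
    "y \<noteq> w \<Longrightarrow> strictly_negative (ncoeff C y)"
    "q_polynomial (vpow (int (len w) - int (len y)) * ncoeff C y)"
  using assms unfolding is_kl_element_def by blast+

lemma is_kl_element_unique:
  assumes "is_kl_element w C" "is_kl_element w C'" shows "C = C'"
proof -
  have "C - C' = 0"
  proof (rule bar_invariant_strictly_negative_eq_0)
    show "hecke_bar (C - C') = C - C'"
      using assms[THEN is_kl_elementD(1)] by (simp add: hecke_bar.diff)
    show "strictly_negative (ncoeff (C - C') y)" for y
      using assms[THEN is_kl_elementD(2)] assms[THEN is_kl_elementD(4)]
      by (cases "y = w") (simp_all add: ncoeff_diff strictly_negative_diff)
  qed
  then show ?thesis by simp
qed

lemma ncoeff_kl_element_eq_0:
  "is_kl_element w C \<Longrightarrow> len w \<le> len y \<Longrightarrow> y \<noteq> w \<Longrightarrow> ncoeff C y = 0"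
  using is_kl_elementD(3)[of w C y] bruhat_le_len[of y w] by auto

definition kl_lower :: "gen \<Rightarrow> weyl \<Rightarrow> weyl set" where
  "kl_lower a w = {z. bruhat_less z w \<and> a \<in> descents z}"

lemma kl_lowerD: "z \<in> kl_lower a w \<Longrightarrow> bruhat_less z w" "z \<in> kl_lower a w \<Longrightarrow> a \<in> descents z"
  by (simp_all add: kl_lower_def)

lemma len_kl_lower: "z \<in> kl_lower a w \<Longrightarrow> len z < len w"
  using kl_lowerD(1) by (rule bruhat_less_len)

lemma finite_kl_lower: "finite (kl_lower a w)"
  by (rule finite_subset[OF _ finite_bruhat_le[of w]]) (auto simp: kl_lower_def bruhat_less_def)

definition kl_step :: "(weyl \<Rightarrow> hecke) \<Rightarrow> gen \<Rightarrow> weyl \<Rightarrow> hecke" where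
  "kl_step K a w = C_simple_mult a (K w) -
     (\<Sum>z\<in>kl_lower a w. hscale (of_int (lookup (ncoeff (K w) z) (- 1))) (K z))"

lemma ncoeff_kl_step:
  "ncoeff (kl_step K a w) y =
     ncoeff (K w) (simple a * y) + vpow (if a \<in> descents y then 1 else - 1) * ncoeff (K w) y -
     (\<Sum>z\<in>kl_lower a w. of_int (lookup (ncoeff (K w) z) (- 1)) * ncoeff (K z) y)"
  by (simp add: kl_step_def ncoeff_diff ncoeff_C_simple_mult ncoeff_sum ncoeff_scale)

context
  fixes K :: "weyl \<Rightarrow> hecke" and a :: gen and w :: weyl
  assumes K: "\<And>z. len z \<le> len w \<Longrightarrow> is_kl_element z (K z)" and a: "a \<notin> descents w"
begin

lemma is_kl_element_kl_lower: "z \<in> kl_lower a w \<Longrightarrow> is_kl_element z (K z)"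
  using K len_kl_lower by fastforce

lemma hecke_bar_kl_step: "hecke_bar (kl_step K a w) = kl_step K a w"
  by (simp add: kl_step_def hecke_bar.diff hecke_bar.sum hecke_bar.scale hecke_bar_C_simple_mult
      is_kl_elementD(1)[OF K] is_kl_elementD(1)[OF is_kl_element_kl_lower])

lemma ncoeff_kl_step_top: "ncoeff (kl_step K a w) (simple a * w) = 1"
proof -
  have "ncoeff (K w) (simple a * w) = 0"
    using ncoeff_kl_element_eq_0[OF K, of w] len_ascent[OF a] by simp
  moreover have "ncoeff (K z) (simple a * w) = 0" if z: "z \<in> kl_lower a w" for z
    using ncoeff_kl_element_eq_0[OF is_kl_element_kl_lower[OF z], of "simple a * w"]
      len_kl_lower[OF z] len_ascent[OF a] by force
  ultimately show ?thesis using is_kl_elementD(2)[OF K[of w]] by (simp add: ncoeff_kl_step)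
qed

lemma bruhat_le_kl_step:
  assumes "ncoeff (kl_step K a w) y \<noteq> 0" shows "bruhat_le y (simple a * w)"
proof -
  have kl_w: "is_kl_element w (K w)" by (simp add: K)
  consider (translate) "ncoeff (K w) (simple a * y) \<noteq> 0" | (same) "ncoeff (K w) y \<noteq> 0"
    | (lower) z where "z \<in> kl_lower a w" "ncoeff (K z) y \<noteq> 0"
    using assms unfolding ncoeff_kl_step by fastforce
  then show ?thesis
  proof cases
    case translate
    then have "bruhat_le (simple a * y) w" using is_kl_elementD(3)[OF kl_w] by blast
    from bruhat_le_ascent(2)[OF this a] show ?thesis by simp
  next
    case same
    then show ?thesis using is_kl_elementD(3)[OF kl_w] bruhat_le_ascent(1)[OF _ a] by blast
  next
    case (lower z)
    then have "bruhat_le y z" "bruhat_le z w"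
      using is_kl_elementD(3)[OF is_kl_element_kl_lower] kl_lowerD by (auto simp: bruhat_less_def)
    then show ?thesis using bruhat_le_ascent(1)[OF _ a] bruhat_le_trans by blast
  qed
qed

lemma strictly_negative_kl_step:
  assumes y: "y \<noteq> simple a * w" shows "strictly_negative (ncoeff (kl_step K a w) y)"
proof -
  let ?\<mu> = "\<lambda>z. lookup (ncoeff (K w) z) (- 1)"
  let ?rest = "\<Sum>z\<in>kl_lower a w - {y}. of_int (?\<mu> z) * ncoeff (K z) y"
  have kl_w: "is_kl_element w (K w)" by (simp add: K)
  have rest: "strictly_negative ?rest"
    using is_kl_elementD(4)[OF is_kl_element_kl_lower]
    by (intro strictly_negative_sum strictly_negative_of_int_mult) auto
  have "simple a * y \<noteq> w" using y by auto
  then have first: "strictly_negative (ncoeff (K w) (simple a * y))"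
    by (rule is_kl_elementD(4)[OF kl_w])
  show ?thesis
  proof (cases "a \<in> descents y")
    case False
    then have "kl_lower a w = kl_lower a w - {y}" by (auto simp: kl_lower_def)
    moreover have "strictly_negative (vpow (- 1) * ncoeff (K w) y)"
      using is_kl_elementD(2,4)[OF kl_w] by (metis strictly_negative_vpow_minus_one_mult)
    ultimately show ?thesis
      using False first rest
      by (simp add: ncoeff_kl_step strictly_negative_add strictly_negative_diff)
  next
    case True
    then have y_neq_w: "y \<noteq> w" using a by auto
    have "?\<mu> y = 0" if "y \<notin> kl_lower a w"
    proof -
      have "ncoeff (K w) y = 0"
        using that True y_neq_w is_kl_elementD(3)[OF kl_w, of y]
        by (auto simp: kl_lower_def bruhat_less_def)
      then show ?thesis by simp
    qed
    then have "(\<Sum>z\<in>kl_lower a w. of_int (?\<mu> z) * ncoeff (K z) y) = of_int (?\<mu> y) + ?rest"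
      using finite_kl_lower is_kl_elementD(2)[OF is_kl_element_kl_lower]
      by (cases "y \<in> kl_lower a w") (simp_all add: sum.remove)
    then have "ncoeff (kl_step K a w) y = ncoeff (K w) (simple a * y) +
        (vpow 1 * ncoeff (K w) y - of_int (?\<mu> y)) - ?rest"
      using True by (simp add: ncoeff_kl_step)
    then show ?thesis
      using first rest strictly_negative_vpow_one_mult_diff[OF is_kl_elementD(4)[OF kl_w y_neq_w]]
      by (simp add: strictly_negative_add strictly_negative_diff)
  qed
qed

lemma q_polynomial_kl_step:
  "q_polynomial (vpow (int (len (simple a * w)) - int (len y)) * ncoeff (kl_step K a w) y)"
proof -
  let ?\<mu> = "\<lambda>z. lookup (ncoeff (K w) z) (- 1)"
  let ?n = "int (len (simple a * w)) - int (len y)"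
  let ?e = "if a \<in> descents y then 1 else - 1 :: int"
  note q_polynomial_w = is_kl_elementD(5)[OF K[of w, OF order.refl]]
  have n: "?n = int (len w) + 1 - int (len y)" using len_ascent[OF a] by simp
  have "q_polynomial (vpow ?n * ncoeff (K w) (simple a * y))"
    using len_simple_mult[of a y] by (intro q_polynomial_shift[OF q_polynomial_w]) (auto simp: n)
  moreover have "q_polynomial (vpow (?n + ?e) * ncoeff (K w) y)"
    by (rule q_polynomial_shift[OF q_polynomial_w]) (auto simp: n)
  moreover have "q_polynomial (vpow ?n * (of_int (?\<mu> z) * ncoeff (K z) y))"
    if z: "z \<in> kl_lower a w" for z
  proof (cases "?\<mu> z = 0")
    case False
    then have "lookup (vpow (int (len w) - int (len z)) * ncoeff (K w) z)
        (int (len w) - int (len z) - 1) \<noteq> 0"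
      by (simp add: lookup_vpow_mult)
    with q_polynomial_w[of z]
    have "0 \<le> int (len w) - int (len z) - 1 \<and> even (int (len w) - int (len z) - 1)"
      unfolding q_polynomial_def by blast
    then have "q_polynomial (vpow ?n * ncoeff (K z) y)"
      by (intro q_polynomial_shift[OF is_kl_elementD(5)[OF is_kl_element_kl_lower[OF z]]])
        (auto simp: n)
    then show ?thesis
      using q_polynomial_of_int_mult by (metis mult.left_commute)
  qed simp
  ultimately have "q_polynomial (vpow ?n * ncoeff (K w) (simple a * y) +
      vpow (?n + ?e) * ncoeff (K w) y -
      (\<Sum>z\<in>kl_lower a w. vpow ?n * (of_int (?\<mu> z) * ncoeff (K z) y)))"
    by (intro q_polynomial_diff q_polynomial_add q_polynomial_sum)
  then show ?thesis
    by (simp only: ncoeff_kl_step distrib_left right_diff_distrib sum_distrib_left vpow_mult_assoc)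
qed

lemma is_kl_element_kl_step: "is_kl_element (simple a * w) (kl_step K a w)"
  unfolding is_kl_element_def
  using hecke_bar_kl_step ncoeff_kl_step_top bruhat_le_kl_step strictly_negative_kl_step
    q_polynomial_kl_step by blast

end

lemma is_kl_element_one: "is_kl_element 1 (T_basis 1)"
  unfolding is_kl_element_def
  by (auto simp: ncoeff_T_basis_1 when_def q_polynomial_def lookup_one)

lemma ex_is_kl_element: "\<exists>C. is_kl_element w C"
proof (induction "len w" arbitrary: w rule: less_induct)
  case less
  show ?case
  proof (cases "w = 1")
    case True
    then show ?thesis using is_kl_element_one by blast
  next
    case False
    then obtain a x where x: "w = simple a * x" "a \<notin> descents x" "len w = len x + 1"
      by (rule obtain_ascent_factor)
    define K where "K z = (SOME C. is_kl_element z C)" for z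
    have "is_kl_element z (K z)" if "len z \<le> len x" for z
      unfolding K_def using less[of z] that x(3) by (auto intro: someI_ex)
    then show ?thesis unfolding x(1) using is_kl_element_kl_step[of x K, OF _ x(2)] by blast
  qed
qed

subsection \<open>Kazhdan--Lusztig polynomials\<close>

lemma ncoeff_kl_element:
  assumes "\<And>y. \<not> bruhat_le y w \<Longrightarrow> P y w = 0"
  shows "ncoeff (kl_element P w) y = vpow (int (len y) - int (len w)) * poly_in_q (P y w)"
proof -
  have "(\<Sum>x\<in>{y. bruhat_le y w}. poly_in_q (P x w) * lookup (T_basis x) y) =
    (\<Sum>x\<in>{y. bruhat_le y w}. if x = y then poly_in_q (P y w) else 0)"
    by (intro sum.cong) (auto simp: lookup_T_basis when_def)
  also have "\<dots> = poly_in_q (P y w)"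
    using assms finite_bruhat_le by simp
  finally show ?thesis
    by (simp add: ncoeff_def kl_element_def lookup_sum vpow_mult_assoc)
qed

lemma is_kl_family_iff:
  "is_kl_family P \<longleftrightarrow> (\<forall>y w. \<not> bruhat_le y w \<longrightarrow> P y w = 0) \<and> (\<forall>w. is_kl_element w (kl_element P w))"
proof (cases "\<forall>y w. \<not> bruhat_le y w \<longrightarrow> P y w = 0")
  case True
  then have coeffs: "ncoeff (kl_element P w) y =
      vpow (int (len y) - int (len w)) * poly_in_q (P y w)" for y w
    by (intro ncoeff_kl_element) blast
  have "ncoeff (kl_element P w) w = 1 \<longleftrightarrow> P w w = 1" for w
    using poly_in_q_eq_iff[of "P w w" 1] by (simp add: coeffs)
  moreover have "ncoeff (kl_element P w) y \<noteq> 0 \<longrightarrow> bruhat_le y w" for y w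
    using True unfolding coeffs by (metis poly_in_q_0 mult_zero_right)
  moreover have "q_polynomial (vpow (int (len w) - int (len y)) * ncoeff (kl_element P w) y)"
    for y w
    by (simp add: coeffs vpow_mult_assoc q_polynomial_iff)
  moreover have "(y \<noteq> w \<longrightarrow> strictly_negative (ncoeff (kl_element P w) y)) \<longleftrightarrow>
      (bruhat_less y w \<longrightarrow> 2 * degree (P y w) + 1 \<le> len w - len y)" for y w
  proof (cases "P y w = 0")
    case False
    then have "strictly_negative (ncoeff (kl_element P w) y) \<longleftrightarrow>
        2 * int (degree (P y w)) < int (len w) - int (len y)"
      using strictly_negative_vpow_mult_poly_in_q[OF False, of "int (len w) - int (len y)"]
      by (simp add: coeffs)
    moreover have "bruhat_le y w" using True False by blast
    ultimately show ?thesis using bruhat_less_len[of y w] by (auto simp: bruhat_less_def)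
  qed (use bruhat_less_len[of y w] in \<open>auto simp: coeffs\<close>)
  ultimately show ?thesis using True unfolding is_kl_family_def is_kl_element_def by auto
qed (auto simp: is_kl_family_def)

lemma ex_is_kl_family: "\<exists>P. is_kl_family P"
proof -
  obtain K where K: "\<And>w. is_kl_element w (K w)" using ex_is_kl_element by metis
  define P where "P y w = inv poly_in_q (vpow (int (len w) - int (len y)) * ncoeff (K w) y)" for y w
  have P: "poly_in_q (P y w) = vpow (int (len w) - int (len y)) * ncoeff (K w) y" for y w
    unfolding P_def using is_kl_elementD(5)[OF K] q_polynomial_iff by (blast intro: f_inv_into_f)
  have support: "P y w = 0" if "\<not> bruhat_le y w" for y w
    using that P[of y w] is_kl_elementD(3)[OF K] poly_in_q_eq_iff[of _ 0] by fastforce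
  have "kl_element P w = K w" for w
    by (rule ncoeff_eqI) (simp add: ncoeff_kl_element support P vpow_mult_assoc)
  then show ?thesis using K support is_kl_family_iff by metis
qed

lemma is_kl_family_unique:
  assumes "is_kl_family P" "is_kl_family Q" shows "P = Q"
proof (intro ext)
  fix y w
  have "kl_element P w = kl_element Q w"
    using assms is_kl_element_unique unfolding is_kl_family_iff by blast
  then have "vpow (int (len y) - int (len w)) * poly_in_q (P y w) =
      vpow (int (len y) - int (len w)) * poly_in_q (Q y w)"
    using assms ncoeff_kl_element[of w P y] ncoeff_kl_element[of w Q y]
    by (auto simp: is_kl_family_iff)
  then show "P y w = Q y w" by simp
qed

lemma is_kl_family_KL: "is_kl_family KL"
  unfolding KL_def using ex_is_kl_family is_kl_family_unique by (metis theI)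

lemma is_kl_element_C_basis: "is_kl_element w (C_basis w)"
  unfolding C_basis_def using is_kl_family_KL is_kl_family_iff by blast

lemma C_basis_eqI: "is_kl_element w C \<Longrightarrow> C_basis w = C"
  using is_kl_element_C_basis is_kl_element_unique by blast

lemma C_basis_1 [simp]: "C_basis 1 = T_basis 1"
  by (rule C_basis_eqI[OF is_kl_element_one])

definition kl_coeff :: "weyl \<Rightarrow> weyl \<Rightarrow> laurent" where
  "kl_coeff y w = ncoeff (C_basis w) y"

definition mu_coeff :: "weyl \<Rightarrow> weyl \<Rightarrow> int" where
  "mu_coeff y w = lookup (kl_coeff y w) (- 1)"

lemma kl_coeff_self [simp]: "kl_coeff w w = 1"
  unfolding kl_coeff_def by (rule is_kl_elementD(2)[OF is_kl_element_C_basis])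

lemma lookup_kl_coeff_nonneg: "y \<noteq> w \<Longrightarrow> 0 \<le> k \<Longrightarrow> lookup (kl_coeff y w) k = 0"
  using is_kl_elementD(4)[OF is_kl_element_C_basis]
  by (simp add: kl_coeff_def strictly_negative_def)

lemma lookup_kl_coeff_pos: "0 < k \<Longrightarrow> lookup (kl_coeff y w) k = 0"
  using lookup_kl_coeff_nonneg[of y w k] by (cases "y = w") (auto simp: lookup_one when_def)

lemma kl_coeff_eq_0: "len w \<le> len y \<Longrightarrow> y \<noteq> w \<Longrightarrow> kl_coeff y w = 0"
  unfolding kl_coeff_def by (rule ncoeff_kl_element_eq_0[OF is_kl_element_C_basis])

lemma mu_eq_mu_coeff:
  assumes "len u < len w" shows "mu u w = mu_coeff u w"
proof -
  define n where "n = len w - len u - 1"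
  have n: "int (len w) = int (len u) + int n + 1" "odd (len w - len u) \<longleftrightarrow> even n"
    using assms by (auto simp: n_def)
  have "kl_coeff u w = vpow (int (len u) - int (len w)) * poly_in_q (KL u w)"
    unfolding kl_coeff_def C_basis_def
    using is_kl_family_KL by (intro ncoeff_kl_element) (auto simp: is_kl_family_iff)
  then have "mu_coeff u w = lookup (poly_in_q (KL u w)) (int n)"
    by (simp add: mu_coeff_def lookup_vpow_mult n)
  moreover have "nat (int n div 2) = n div 2" by (metis nat_int of_nat_numeral zdiv_int)
  ultimately show ?thesis unfolding lookup_poly_in_q mu_def n(2) by (simp add: n_def)
qed

lemma C_basis_winv: "C_basis (winv w) = hinv (C_basis w)"
proof (rule C_basis_eqI)
  note C = is_kl_elementD[OF is_kl_element_C_basis]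
  show "is_kl_element (winv w) (hinv (C_basis w))"
    unfolding is_kl_element_def
  proof (intro conjI allI impI)
    show "hecke_bar (hinv (C_basis w)) = hinv (C_basis w)"
      by (simp add: hecke_bar_hinv C(1))
    show "ncoeff (hinv (C_basis w)) (winv w) = 1"
      by (simp add: ncoeff_hinv C(2))
    fix y
    show "bruhat_le y (winv w)" if "ncoeff (hinv (C_basis w)) y \<noteq> 0"
      using that C(3)[where y = "winv y"] bruhat_le_winv[of "winv y" w] by (simp add: ncoeff_hinv)
    show "strictly_negative (ncoeff (hinv (C_basis w)) y)" if "y \<noteq> winv w"
    proof -
      have "winv y \<noteq> w" using that by auto
      then show ?thesis using C(4)[where y = "winv y"] by (simp add: ncoeff_hinv)
    qed
    show "q_polynomial (vpow (int (len (winv w)) - int (len y)) * ncoeff (hinv (C_basis w)) y)"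
      using C(5)[where y = "winv y"] by (simp add: ncoeff_hinv)
  qed
qed

lemma kl_coeff_winv: "kl_coeff (winv y) (winv w) = kl_coeff y w"
  by (simp add: kl_coeff_def C_basis_winv ncoeff_hinv)

lemma mu_coeff_winv: "mu_coeff (winv y) (winv w) = mu_coeff y w"
  by (simp add: mu_coeff_def kl_coeff_winv)

subsection \<open>Multiplication by \<open>C\<^sub>a\<close>\<close>

lemma C_simple_mult_ascent:
  assumes "a \<notin> descents w"
  shows "C_simple_mult a (C_basis w) = C_basis (simple a * w) +
    (\<Sum>z\<in>kl_lower a w. hscale (of_int (mu_coeff z w)) (C_basis z))"
  using C_basis_eqI[OF is_kl_element_kl_step[of w C_basis a, OF is_kl_element_C_basis assms]]
  by (simp add: kl_step_def mu_coeff_def kl_coeff_def)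

lemma C_simple_mult_descent:
  "a \<in> descents w \<Longrightarrow> C_simple_mult a (C_basis w) = hscale quantum_two (C_basis w)"
proof (induction "len w" arbitrary: w rule: less_induct)
  case less
  define x where "x = simple a * w"
  have x: "w = simple a * x" "a \<notin> descents x" "len x < len w"
    using less.prems len_descent[OF less.prems] by (simp_all add: x_def)
  let ?S = "\<Sum>z\<in>kl_lower a x. hscale (of_int (mu_coeff z x)) (C_basis z)"
  have C_basis_w: "C_basis w = C_simple_mult a (C_basis x) - ?S"
    using C_simple_mult_ascent[OF x(2)] x(1) by simp
  have "C_simple_mult a (C_basis z) = hscale quantum_two (C_basis z)" if "z \<in> kl_lower a x" for z
    using less.hyps[of z] len_kl_lower[OF that] kl_lowerD(2)[OF that] x(3) by simp
  then have "C_simple_mult a ?S = hscale quantum_two ?S"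
    by (simp add: C_simple_mult.sum C_simple_mult.scale hecke.scale_sum_right mult.commute)
  then show ?case unfolding C_basis_w
    by (simp add: C_simple_mult.diff C_simple_mult_square hecke.scale_right_diff_distrib)
qed

lemma kl_coeff_ascent:
  assumes "a \<in> descents w" "a \<notin> descents y"
  shows "kl_coeff y w = vpow (- 1) * kl_coeff (simple a * y) w"
proof -
  have "ncoeff (C_simple_mult a (C_basis w)) y = quantum_two * kl_coeff y w"
    using C_simple_mult_descent[OF assms(1)] by (simp add: ncoeff_scale kl_coeff_def)
  then have "kl_coeff (simple a * y) w = vpow 1 * kl_coeff y w"
    using assms(2) by (simp add: ncoeff_C_simple_mult kl_coeff_def quantum_two_def distrib_right)
  then show ?thesis by (simp add: vpow_mult_assoc)
qed

lemma mu_coeff_eq_0_if_descent: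
  assumes "a \<in> descents w" "a \<notin> descents y" "simple a * y \<noteq> w"
  shows "mu_coeff y w = 0"
  using lookup_kl_coeff_nonneg[OF assms(3), of 0]
  by (simp add: mu_coeff_def kl_coeff_ascent[OF assms(1,2)] lookup_vpow_mult)

lemma kl_coeff_bruhat_step:
  "bruhat_step u w \<Longrightarrow> len w = len u + 1 \<Longrightarrow> kl_coeff u w = vpow (- 1)"
proof (induction "len w" arbitrary: u w rule: less_induct)
  case less
  have "w \<noteq> 1" using less.prems by auto
  then obtain a x where x: "w = simple a * x" "a \<notin> descents x" "len w = len x + 1"
    by (rule obtain_ascent_factor)
  then have a: "a \<in> descents w" by simp
  show ?case
  proof (cases "a \<in> descents u")
    case False
    have "simple a * u = w"
      using bruhat_step_simple_mult[OF less.prems(1), of a] bruhat_step_len[of "simple a * u" x]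
        len_ascent[OF False] less.prems(2) x by auto
    then show ?thesis using kl_coeff_ascent[OF a False] by simp
  next
    case True
    have len_u: "len u = len (simple a * u) + 1" by (rule len_descent[OF True])
    then have "simple a * u \<noteq> w" using less.prems(2) by auto
    then have "bruhat_step (simple a * u) x"
      using bruhat_step_simple_mult[OF less.prems(1), of a] x(1) by simp
    then have "kl_coeff (simple a * u) x = vpow (- 1)"
      using less.hyps[of x "simple a * u"] x len_u less.prems(2) by simp
    moreover have "kl_coeff u x = 0"
      using kl_coeff_eq_0[of x u] x less.prems(2) True by auto
    moreover have "kl_coeff u z = 0" if "z \<in> kl_lower a x" for z
      using kl_coeff_eq_0[of z u] len_kl_lower[OF that] x less.prems(2) by auto
    moreover have "ncoeff (C_simple_mult a (C_basis x)) u =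
        kl_coeff u w + (\<Sum>z\<in>kl_lower a x. of_int (mu_coeff z x) * kl_coeff u z)"
      using C_simple_mult_ascent[OF x(2)] x(1)
      by (simp add: ncoeff_add ncoeff_sum ncoeff_scale kl_coeff_def)
    ultimately show ?thesis by (simp add: ncoeff_C_simple_mult kl_coeff_def)
  qed
qed

lemma mu_coeff_len_1: "bruhat_le u w \<Longrightarrow> len w = len u + 1 \<Longrightarrow> mu_coeff u w = 1"
  using kl_coeff_bruhat_step bruhat_le_imp_step by (simp add: mu_coeff_def lookup_vpow)

subsection \<open>Coordinates in the Kazhdan--Lusztig basis\<close>

lemma lookup_C_basis_longer: "len w \<le> len y \<Longrightarrow> w \<noteq> y \<Longrightarrow> lookup (C_basis w) y = 0"
  using kl_coeff_eq_0[of w y] by (auto simp: lookup_eq_ncoeff kl_coeff_def)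

lemma lookup_C_basis_self: "lookup (C_basis w) w = vpow (- int (len w))"
  using kl_coeff_self[of w] by (simp add: lookup_eq_ncoeff kl_coeff_def del: kl_coeff_self)

lemma span_C_basis: "hecke.span (range C_basis) = UNIV"
proof -
  have "T_basis w \<in> hecke.span (range C_basis)" for w
  proof (induction "len w" arbitrary: w rule: less_induct)
    case less
    let ?D = "hscale (vpow (int (len w))) (C_basis w) - T_basis w"
    have "len y < len w" if "y \<in> keys ?D" for y
    proof (rule ccontr)
      assume "\<not> len y < len w"
      then have "lookup ?D y = 0"
        using lookup_C_basis_longer[of w y] lookup_C_basis_self[of w]
        by (cases "y = w") (auto simp: lookup_minus lookup_T_basis vpow_mult)
      with that show False by (simp add: in_keys_iff)
    qed
    then have "?D \<in> hecke.span (range C_basis)"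
      by (subst hecke_expansion) (intro hecke.span_sum hecke.span_scale less)
    then have "hscale (vpow (int (len w))) (C_basis w) - ?D \<in> hecke.span (range C_basis)"
      using hecke.span_diff[OF hecke.span_scale[OF hecke.span_base]] by blast
    then show ?case by simp
  qed
  then have "hecke.span (range T_basis) \<subseteq> hecke.span (range C_basis)"
    by (intro hecke.span_minimal) auto
  then show ?thesis by (simp add: span_T_basis top_le)
qed

definition C_comb :: "hecke \<Rightarrow> hecke" where
  "C_comb = linear_extension (\<lambda>c. c) C_basis"

interpretation C_comb: module_hom hscale hscale C_comb
  unfolding C_comb_def by (rule module_hom_linear_extension[OF is_ring_hom_ident])

lemma C_comb_T_basis [simp]: "C_comb (T_basis w) = C_basis w"
  unfolding C_comb_def by (rule linear_extension_T_basis[OF is_ring_hom_ident])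

lemma C_comb_eq_0_imp:
  assumes "C_comb h = 0" shows "h = 0"
proof (rule ccontr)
  assume "h \<noteq> 0"
  then obtain y where y: "y \<in> keys h" "\<And>w. w \<in> keys h \<Longrightarrow> len w \<le> len y"
    using obtain_longest_key by blast
  have "lookup (C_comb h) y = lookup h y * vpow (- int (len y))"
    unfolding C_comb_def
    by (subst lookup_linear_extension_longest[OF y is_ring_hom_ident])
      (simp_all add: lookup_C_basis_longer lookup_C_basis_self)
  then have "vpow (- int (len y)) * lookup h y = 0" using assms by (simp add: mult.commute)
  with y(1) show False by (simp add: in_keys_iff)
qed

lemma bij_C_comb: "bij C_comb"
proof (rule bijI)
  show "inj C_comb" unfolding C_comb.inj_iff_eq_0 using C_comb_eq_0_imp by blast
  have "range C_comb = hecke.span (range C_basis)"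
    using C_comb.span_image[of "range T_basis"] by (simp add: span_T_basis image_image)
  then show "surj C_comb" by (simp add: span_C_basis)
qed

definition C_coord :: "hecke \<Rightarrow> hecke" where
  "C_coord = inv C_comb"

lemma C_comb_C_coord [simp]: "C_comb (C_coord h) = h"
  unfolding C_coord_def by (rule surj_f_inv_f[OF bij_is_surj[OF bij_C_comb]])

lemma C_coord_C_comb [simp]: "C_coord (C_comb h) = h"
  unfolding C_coord_def by (rule inv_f_f[OF bij_is_inj[OF bij_C_comb]])

lemma C_coord_C_basis: "C_coord (C_basis w) = T_basis w"
  using C_coord_C_comb[of "T_basis w"] by simp

interpretation C_coord: module_hom hscale hscale C_coord
proof -
  interpret module_pair hscale hscale by (simp add: module_pair_def hecke.module_axioms)
  show "module_hom hscale hscale C_coord"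
    unfolding C_coord_def
    using C_comb.module_hom_axioms bij_C_comb by (rule bij_module_hom_imp_inv_module_hom)
qed

definition C_coeff :: "hecke \<Rightarrow> weyl \<Rightarrow> laurent" where
  "C_coeff h = lookup (C_coord h)"

lemma structure_const_eq_C_coeff: "structure_const x y = C_coeff (hmult (C_basis x) (C_basis y))"
proof -
  have "(THE h. hmult (C_basis x) (C_basis y) = C_comb h) = C_coord (hmult (C_basis x) (C_basis y))"
    by (rule the_equality) auto
  then show ?thesis by (simp add: structure_const_def C_coeff_def C_comb_def linear_extension_def)
qed

lemma C_coeff_0 [simp]: "C_coeff 0 z = 0"
  by (simp add: C_coeff_def)

lemma C_coeff_add: "C_coeff (h + h') z = C_coeff h z + C_coeff h' z"
  by (simp add: C_coeff_def C_coord.add lookup_add)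

lemma C_coeff_scale: "C_coeff (hscale a h) z = a * C_coeff h z"
  by (simp add: C_coeff_def C_coord.scale)

lemma C_coeff_C_basis: "C_coeff (C_basis w) z = (1 when z = w)"
  by (simp add: C_coeff_def C_coord_C_basis lookup_T_basis)

section \<open>Rigid elements below braided ones\<close>

lemma kl_coeff_longest_ascent:
  assumes "p \<noteq> q" "p \<in> descents w" "q \<in> descents w" "p \<notin> descents y" "q \<notin> descents y"
  shows "kl_coeff y w = vpow (- 3) * kl_coeff (longest p q * y) w"
  using kl_coeff_ascent[OF assms(2,4)]
    kl_coeff_ascent[OF assms(3) longest_ascents(1)[OF assms(1,4,5)]]
    kl_coeff_ascent[OF assms(2) longest_ascents(2)[OF assms(1,4,5)]]
  by (simp add: longest_mult vpow_mult_assoc)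

lemma lookup_kl_coeff_longest_ascent:
  assumes "p \<noteq> q" "p \<in> descents w" "q \<in> descents w" "p \<notin> descents y" "q \<notin> descents y" "- 2 \<le> k"
  shows "lookup (kl_coeff y w) k = 0"
  using assms(6)
  by (simp add: kl_coeff_longest_ascent[OF assms(1-5)] lookup_vpow_mult lookup_kl_coeff_pos)

lemma C_simple_mult_two_descents:
  assumes "p \<in> descents m" "q \<in> descents m" "p \<noteq> q" and a: "a \<notin> descents m"
  shows "C_simple_mult a (C_basis m) = C_basis (simple a * m)"
proof -
  have distinct: "a \<noteq> p" "a \<noteq> q" using assms by auto
  have "mu_coeff z m = 0" if z: "z \<in> kl_lower a m" for z
  proof -
    have a_in_z: "a \<in> descents z" using z by (rule kl_lowerD)
    then obtain r r' where r: "r \<in> descents m" "r' \<in> descents m" "r \<noteq> r'"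
        "r \<notin> descents z" "a \<noteq> r" "a \<noteq> r'"
      using third_not_in_descents[of a z p q] assms distinct by metis
    moreover have "simple r * z \<noteq> m"
      using third_not_in_descents_simple_mult[OF r(1,2,3), of a] r a_in_z by auto
    ultimately show ?thesis using mu_coeff_eq_0_if_descent by blast
  qed
  then show ?thesis using C_simple_mult_ascent[OF a] by simp
qed

lemma kl_coeff_two_descents:
  assumes "p \<in> descents m" "q \<in> descents m" "p \<noteq> q" "a \<notin> descents m"
  shows "kl_coeff y (simple a * m) =
    kl_coeff (simple a * y) m + vpow (if a \<in> descents y then 1 else - 1) * kl_coeff y m"
  using ncoeff_C_simple_mult[of a "C_basis m" y] C_simple_mult_two_descents[OF assms]
  by (simp add: kl_coeff_def)

lemma kl_coeff_two_right_descents: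
  assumes "p \<in> right_descents m" "q \<in> right_descents m" "p \<noteq> q" "e \<notin> right_descents m"
  shows "kl_coeff y (m * simple e) =
    kl_coeff (y * simple e) m + vpow (if e \<in> right_descents y then 1 else - 1) * kl_coeff y m"
  using kl_coeff_two_descents[of p "winv m" q e "winv y"] assms
    kl_coeff_winv[of y "m * simple e"] kl_coeff_winv[of "y * simple e" m] kl_coeff_winv[of y m]
  by (simp add: winv_mult)

lemma descents_strip_right:
  assumes m: "braided m" and e: "e \<notin> right_descents m"
    and descents_me: "descents (m * simple e) = - {a}"
  shows "descents m = - {a}"
proof -
  have subset: "descents m \<subseteq> - {a}"
    using descents_mult_simple_subset[of e "m * simple e"] descents_me e by (simp add: mult.assoc)
  obtain x where x: "x \<in> descents m" using braided_not_one[OF m] by (rule descents_nonempty)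
  then have "x \<noteq> a" using subset by auto
  then have x_in_me: "x \<in> descents (m * simple e)" using descents_me by simp
  have "descents m \<noteq> {x}"
  proof
    assume "descents m = {x}"
    then have a_in_xm: "a \<in> descents (simple x * m)"
      using descents_of_unique_descent[OF m] \<open>x \<noteq> a\<close> by auto
    have "len (m * simple e) = len m + 1"
      using len_right_descent[of e "m * simple e"] e by (simp add: mult.assoc)
    then have "len ((simple x * m) * simple e) = len (simple x * m) + len (simple e)"
      using len_descent[OF x] len_descent[OF x_in_me] by (simp add: mult.assoc)
    then have "a \<in> descents (simple x * (m * simple e))"
      using descents_subset_mult[of "simple x * m" "simple e"] a_in_xm by (auto simp: mult.assoc)
    moreover obtain x' where "x' \<noteq> a" "x' \<noteq> x" by (rule obtain_third_gen)
    then have "a \<notin> descents (simple x * (m * simple e))"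
      using third_not_in_descents_simple_mult[OF x_in_me, of x' a] descents_me \<open>x \<noteq> a\<close> by auto
    ultimately show False by simp
  qed
  then obtain y where y: "y \<in> descents m" "y \<noteq> x" using x by blast
  then have "y \<noteq> a" using subset by auto
  then show ?thesis using subset x y \<open>x \<noteq> a\<close> gen_exhaust_distinct[of a x y] by auto
qed

text \<open>This is the step special to type \<open>A\<^sub>2\<close> affine: a braided element with one descent on either
  side is enclosed by these two letters.\<close>

lemma obtain_braided_core:
  assumes w: "braided w" "descents w = {a}" "right_descents w = {e}"
  obtains m where "w = simple a * (m * simple e)" "len w = len m + 2" "braided m"
    "descents (m * simple e) = - {a}" "descents m = - {a}" "right_descents m = - {e}"
proof -
  define n where "n = simple a * w"
  have n: "braided n" "descents n = - {a}" "len w = len n + 1"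
    using w braided_of_unique_descent descents_of_unique_descent len_descent[of a w]
    by (simp_all add: n_def)
  have "right_descents n \<subseteq> {e}"
    using right_descents_simple_mult_subset[of a w] w by (simp add: n_def)
  moreover obtain x where "x \<in> right_descents n"
    using braided_not_one[OF n(1)] by (rule right_descents_nonempty)
  ultimately have right_descents_n: "right_descents n = {e}" by auto
  define m where "m = n * simple e"
  have n_eq: "n = m * simple e" by (simp add: m_def mult.assoc)
  have "braided (winv m)" "descents (winv m) = - {e}"
    using braided_of_unique_descent[of "winv n" e] descents_of_unique_descent[of "winv n" e]
      n right_descents_n
    by (simp_all add: m_def winv_mult)
  then have m: "braided m" "right_descents m = - {e}" by simp_all
  show thesis
  proof (rule that[of m])
    show "w = simple a * (m * simple e)" by (simp add: n_eq[symmetric] n_def)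
    show "len w = len m + 2"
      using n(3) len_right_descent[of e n] right_descents_n by (simp add: m_def)
    show "descents (m * simple e) = - {a}" using n(2) n_eq by simp
    then show "descents m = - {a}" using descents_strip_right m by simp
  qed (use m in simp_all)
qed

lemma kl_coeff_sandwich:
  assumes "descents (m * simple e) = - {a}" "right_descents m = - {e}"
    and u: "a \<in> descents u" "e \<in> right_descents u"
  shows "kl_coeff u (simple a * (m * simple e)) =
    kl_coeff (simple a * u * simple e) m +
    vpow (if e \<in> right_descents (simple a * u) then 1 else - 1) * kl_coeff (simple a * u) m +
    vpow 1 * kl_coeff (u * simple e) m + vpow 2 * kl_coeff u m"
proof -
  obtain b c where bc: "b \<noteq> a" "c \<noteq> a" "b \<noteq> c" by (rule obtain_other_gens)
  obtain f g where fg: "f \<noteq> e" "g \<noteq> e" "f \<noteq> g" by (rule obtain_other_gens)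
  have "kl_coeff u (simple a * (m * simple e)) =
      kl_coeff (simple a * u) (m * simple e) + vpow 1 * kl_coeff u (m * simple e)"
    using kl_coeff_two_descents[of b "m * simple e" c a u] bc assms by simp
  moreover have "kl_coeff y (m * simple e) =
      kl_coeff (y * simple e) m +
      vpow (if e \<in> right_descents y then 1 else - 1) * kl_coeff y m" for y
    using fg assms by (intro kl_coeff_two_right_descents[of f m g]) auto
  ultimately show ?thesis
    using u by (simp add: distrib_left vpow_mult_assoc add.assoc)
qed

context
  fixes m u :: weyl and a e :: gen
  assumes m: "braided m" "descents m = - {a}" "right_descents m = - {e}"
    and u: "rigid u" "descents u = {a}" "right_descents u = {e}"
begin

lemma not_braided_strip_left: "\<not> braided (simple a * u)"
  using not_braided_descent[of u a] u by (simp add: rigid_def)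

lemma right_descents_strip_left: "right_descents (simple a * u) \<subseteq> {e}"
  using right_descents_simple_mult_subset[of a u] u by simp

lemma lookup_kl_coeff_strip_left:
  "lookup (kl_coeff (simple a * u) m) (if e \<in> right_descents (simple a * u) then - 2 else 0) = 0"
proof (cases "e \<in> right_descents (simple a * u)")
  case True
  obtain f g where fg: "f \<noteq> e" "g \<noteq> e" "f \<noteq> g" by (rule obtain_other_gens)
  have "lookup (kl_coeff (winv (simple a * u)) (winv m)) (- 2) = 0"
    using fg m(3) right_descents_strip_left
    by (intro lookup_kl_coeff_longest_ascent[of f g]) auto
  then show ?thesis using True by (simp only: kl_coeff_winv if_True)
next
  case False
  have "simple a * u \<noteq> m" using m(1) not_braided_strip_left by auto
  then show ?thesis using False lookup_kl_coeff_nonneg by simp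
qed

lemma lookup_kl_coeff_strip_right: "lookup (kl_coeff (u * simple e) m) (- 2) = 0"
proof -
  obtain b c where "b \<noteq> a" "c \<noteq> a" "b \<noteq> c" by (rule obtain_other_gens)
  then show ?thesis
    using descents_mult_simple_subset[of e u] u m(2)
    by (intro lookup_kl_coeff_longest_ascent[of b c]) auto
qed

lemma lookup_kl_coeff_strip_none: "lookup (kl_coeff u m) (- 3) = 0"
proof -
  obtain b c where bc: "b \<noteq> a" "c \<noteq> a" "b \<noteq> c" by (rule obtain_other_gens)
  have "b \<notin> descents u" "c \<notin> descents u" using u bc by auto
  then have "len (longest b c * u) = len (longest b c) + len u"
    using longest_ascents(3) len_longest bc(3) by metis
  then have "longest b c * u \<noteq> m"
    using right_descents_subset_mult u(3) m(3) by fastforce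
  then show ?thesis
    using kl_coeff_longest_ascent[of b c m u] bc u(2) m(2) lookup_kl_coeff_nonneg
    by (simp add: lookup_vpow_mult)
qed

lemma mu_coeff_strip_both:
  assumes len: "len m \<noteq> len u - 1" shows "mu_coeff (simple a * u * simple e) m = 0"
proof -
  let ?y = "simple a * u * simple e"
  have y: "\<not> braided ?y \<and> len m \<noteq> len ?y + 1"
  proof (cases "simple a * u = 1")
    case True
    then show ?thesis using len_braided[of "simple e"] len_braided[OF m(1)] by auto
  next
    case False
    then obtain x where "x \<in> right_descents (simple a * u)" by (rule right_descents_nonempty)
    then have e: "e \<in> right_descents (simple a * u)" using right_descents_strip_left by auto
    have "len u = len ?y + 2" using len_descent[of a u] len_right_descent[OF e] u(2) by simp
    then show ?thesis using not_braided_right_descent[OF not_braided_strip_left e] len by simp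
  qed
  moreover obtain b c where "b \<noteq> a" "c \<noteq> a" "b \<noteq> c" by (rule obtain_other_gens)
  ultimately obtain p where p: "p \<in> descents m" "p \<notin> descents ?y"
    using braided_two_descents[of b ?y c] m(2) by blast
  then have "simple p * ?y \<noteq> m" using len_ascent[OF p(2)] y by auto
  then show ?thesis by (rule mu_coeff_eq_0_if_descent[OF p])
qed

end

lemma mu_coeff_rigid_braided_same_descents:
  assumes u: "rigid u" "descents u = {a}" "right_descents u = {e}"
    and w: "braided w" "descents w = {a}" "right_descents w = {e}"
    and len: "len w \<noteq> len u + 1"
  shows "mu_coeff u w = 0"
proof -
  obtain m where m: "w = simple a * (m * simple e)" "len w = len m + 2" "braided m"
    "descents (m * simple e) = - {a}" "descents m = - {a}" "right_descents m = - {e}"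
    using w by (rule obtain_braided_core)
  have "len m \<noteq> len u - 1" using len m(2) len_descent[of a u] u by simp
  then have "mu_coeff (simple a * u * simple e) m = 0"
    using m u by (intro mu_coeff_strip_both)
  then show ?thesis
    using kl_coeff_sandwich[OF m(4,6), of u] u m(1)
      lookup_kl_coeff_strip_left[OF m(3,5,6) u] lookup_kl_coeff_strip_right[OF m(3,5,6) u]
      lookup_kl_coeff_strip_none[OF m(3,5,6) u]
    by (simp add: mu_coeff_def lookup_add lookup_vpow_mult split: if_splits)
qed

lemma mu_coeff_eq_0_or_same_descents:
  assumes u: "rigid u" and w: "braided w" and len: "len w \<noteq> len u + 1"
  shows "mu_coeff u w = 0 \<or> descents w = descents u"
proof (cases "descents w \<subseteq> descents u")
  case True
  obtain a where "descents u = {a}" using u by (rule obtain_rigid_descent)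
  moreover obtain b where "b \<in> descents w" using braided_not_one[OF w] by (rule descents_nonempty)
  ultimately show ?thesis using True by auto
next
  case False
  then obtain a where a: "a \<in> descents w" "a \<notin> descents u" by blast
  then have "simple a * u \<noteq> w" using len len_ascent[OF a(2)] by auto
  then show ?thesis using mu_coeff_eq_0_if_descent a by blast
qed

lemma mu_coeff_rigid_braided:
  assumes u: "rigid u" and w: "braided w" and len: "len w \<noteq> len u + 1"
  shows "mu_coeff u w = 0"
proof -
  obtain a where a: "descents u = {a}" using u by (rule obtain_rigid_descent)
  obtain e where e: "right_descents u = {e}"
    using u obtain_rigid_descent[of "winv u"] by auto
  have "mu_coeff u w = 0 \<or> right_descents w = right_descents u"
    using mu_coeff_eq_0_or_same_descents[of "winv u" "winv w"] u w len by (simp add: mu_coeff_winv)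
  then show ?thesis
    using mu_coeff_eq_0_or_same_descents[OF u w len]
      mu_coeff_rigid_braided_same_descents[OF u a e w _ _ len] a e by auto
qed

section \<open>The ideal of the braided elements\<close>

definition braided_span :: "hecke set" where
  "braided_span = hecke.span (C_basis ` {w. braided w})"

lemma subspace_braided_span: "hecke.subspace braided_span"
  by (simp add: braided_span_def)

lemma C_basis_braided: "braided w \<Longrightarrow> C_basis w \<in> braided_span"
  by (simp add: braided_span_def hecke.span_base)

lemma braided_span_hom:
  assumes "module_hom hscale hscale F" "\<And>w. braided w \<Longrightarrow> F (C_basis w) \<in> braided_span"
    and "h \<in> braided_span"
  shows "F h \<in> braided_span"
proof -
  interpret module_hom hscale hscale F by fact
  have "hecke.span (C_basis ` {w. braided w}) \<subseteq> {h. F h \<in> braided_span}"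
    using assms(2) by (intro hecke.span_minimal subspace_linear_preimage subspace_braided_span) auto
  then show ?thesis using assms(3) by (auto simp: braided_span_def)
qed

lemma C_coeff_braided_span:
  assumes "h \<in> braided_span" "\<not> braided z" shows "C_coeff h z = 0"
proof -
  have "hecke.subspace {h. C_coeff h z = 0}"
    by (rule hecke.subspaceI) (simp_all add: C_coeff_add C_coeff_scale)
  then have "braided_span \<subseteq> {h. C_coeff h z = 0}"
    unfolding braided_span_def
    by (rule hecke.span_minimal[rotated]) (use assms(2) in \<open>auto simp: C_coeff_C_basis when_def\<close>)
  then show ?thesis using assms(1) by blast
qed

lemma braided_if_mu_coeff_neq_0:
  assumes w: "braided w" "a \<notin> descents w" and z: "a \<in> descents z" "mu_coeff z w \<noteq> 0"
  shows "braided z"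
proof (rule ccontr)
  assume "\<not> braided z"
  moreover have "z \<noteq> 1" using z(1) by auto
  ultimately have descents_z: "descents z = {a}" using z(1) rigid_descents by (simp add: rigid_def)
  obtain r where r: "r \<in> descents w" using braided_not_one[OF w(1)] by (rule descents_nonempty)
  then have "r \<noteq> a" using w(2) by auto
  then have "simple r * z = w" using mu_coeff_eq_0_if_descent[OF r] descents_z z(2) by auto
  then have z_eq: "z = simple r * w" by auto
  show False
  proof (cases "descents w = {r}")
    case True
    then have "- {r} = {a}" using descents_of_unique_descent[OF w(1)] descents_z z_eq by simp
    moreover obtain x where "x \<noteq> r" "x \<noteq> a" by (rule obtain_third_gen)
    ultimately show False by blast
  next
    case False
    then obtain p where p: "p \<in> descents w" "p \<noteq> r" using r by blast
    then have "p \<in> descents z"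
      using len_simple_simple_mult_of_descents[OF p(1) r] len_descent[OF r] z_eq
      by (simp add: descents_iff)
    then show False using descents_z p(1) w(2) by auto
  qed
qed

lemma C_simple_mult_braided:
  assumes w: "braided w" shows "C_simple_mult a (C_basis w) \<in> braided_span"
proof (cases "a \<in> descents w")
  case True
  then show ?thesis
    by (simp add: C_simple_mult_descent hecke.subspace_scale[OF subspace_braided_span]
        C_basis_braided w)
next
  case False
  have "hscale (of_int (mu_coeff z w)) (C_basis z) \<in> braided_span" if "z \<in> kl_lower a w" for z
    using braided_if_mu_coeff_neq_0[OF w False kl_lowerD(2)[OF that]]
    by (cases "mu_coeff z w = 0")
      (simp_all add: hecke.subspace_0 hecke.subspace_scale subspace_braided_span C_basis_braided)
  then show ?thesis
    unfolding C_simple_mult_ascent[OF False]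
    by (intro hecke.subspace_add hecke.subspace_sum subspace_braided_span C_basis_braided
        braided_ascent w False)
qed

lemma T_simple_mult_braided:
  assumes "braided w" shows "T_simple_mult a (C_basis w) \<in> braided_span"
proof -
  have "T_simple_mult a (C_basis w) = hscale (vpow 1) (C_simple_mult a (C_basis w)) - C_basis w"
    by (simp add: C_simple_mult_def vpow_mult)
  then show ?thesis
    using assms
    by (simp add: hecke.subspace_diff hecke.subspace_scale subspace_braided_span
        C_simple_mult_braided C_basis_braided)
qed

lemma hmult_braided_span_right:
  assumes "h \<in> braided_span" shows "hmult g h \<in> braided_span"
proof -
  have "foldr T_simple_mult xs h \<in> braided_span" for xs
    using assms braided_span_hom[OF T_simple_mult.module_hom_axioms T_simple_mult_braided]
    by (induction xs) simp_all
  then have "hscale c (foldr T_simple_mult xs h) \<in> braided_span" for c xs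
    using hecke.subspace_scale[OF subspace_braided_span] by blast
  then show ?thesis
    unfolding hmult_def by (rule hecke.subspace_sum[OF subspace_braided_span])
qed

lemma hinv_braided_span: "h \<in> braided_span \<Longrightarrow> hinv h \<in> braided_span"
  by (rule braided_span_hom[OF hinv.module_hom_axioms])
    (simp_all add: C_basis_winv[symmetric] C_basis_braided)

lemma hmult_braided_span_left:
  assumes "h \<in> braided_span" shows "hmult h g \<in> braided_span"
  using hinv_braided_span[OF hmult_braided_span_right[OF hinv_braided_span[OF assms], of "hinv g"]]
  by (simp add: hinv_hmult)

section \<open>Structure constants at rigid elements\<close>

interpretation hecke_int: module "\<lambda>n::int. hscale (of_int n)"
  using hecke.module_axioms is_ring_hom_of_int by (rule module_twist)

lemma hecke_int_span_hom:
  assumes "module_hom hscale hscale F" "\<And>g. g \<in> G \<Longrightarrow> F g \<in> A" "hecke_int.subspace A"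
    and "h \<in> hecke_int.span G"
  shows "F h \<in> A"
proof -
  interpret module_hom "\<lambda>n::int. hscale (of_int n)" "\<lambda>n::int. hscale (of_int n)" F
    using assms(1) is_ring_hom_of_int by (rule module_hom_twist)
  have "hecke_int.span G \<subseteq> {h. F h \<in> A}"
    using assms(2,3) by (intro hecke_int.span_minimal subspace_linear_preimage) auto
  then show ?thesis using assms(4) by blast
qed

definition integral_span :: "gen \<Rightarrow> hecke set" where
  "integral_span a = hecke_int.span (braided_span \<union> C_basis ` {w. a \<in> descents w})"

text \<open>\<open>v + v\<^sup>-\<^sup>1\<close> enters only once: the factor arises when the last letter of \<open>x\<close> meets the first
  letter of \<open>y\<close> in \<open>C\<^sub>x C\<^sub>y\<close>.\<close>

definition quantum_span :: "gen \<Rightarrow> hecke set" where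
  "quantum_span a = hecke_int.span (integral_span a \<union> hscale quantum_two ` integral_span a)"

lemma subspace_integral_span: "hecke_int.subspace (integral_span a)"
  by (simp add: integral_span_def)

lemma subspace_quantum_span: "hecke_int.subspace (quantum_span a)"
  by (simp add: quantum_span_def)

lemma braided_span_integral: "h \<in> braided_span \<Longrightarrow> h \<in> integral_span a"
  by (simp add: integral_span_def hecke_int.span_base)

lemma C_basis_integral: "a \<in> descents w \<Longrightarrow> C_basis w \<in> integral_span a"
  by (simp add: integral_span_def hecke_int.span_base)

lemma integral_quantum_span: "h \<in> integral_span a \<Longrightarrow> h \<in> quantum_span a"
  by (simp add: quantum_span_def hecke_int.span_base)

lemma quantum_two_integral_span: "h \<in> integral_span a \<Longrightarrow> hscale quantum_two h \<in> quantum_span a"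
  by (simp add: quantum_span_def hecke_int.span_base)

lemma C_simple_mult_braided_span: "h \<in> braided_span \<Longrightarrow> C_simple_mult a h \<in> braided_span"
  by (rule braided_span_hom[OF C_simple_mult.module_hom_axioms C_simple_mult_braided])

lemma C_simple_mult_ascent_integral:
  assumes "a \<notin> descents w" shows "C_simple_mult a (C_basis w) \<in> integral_span a"
  unfolding C_simple_mult_ascent[OF assms]
  by (intro hecke_int.subspace_add hecke_int.subspace_sum hecke_int.subspace_scale
      subspace_integral_span C_basis_integral) (use assms kl_lowerD in auto)

lemma C_simple_mult_integral:
  assumes "h \<in> integral_span d" "a \<noteq> d" shows "C_simple_mult a h \<in> integral_span a"
proof (rule hecke_int_span_hom[OF C_simple_mult.module_hom_axioms _ subspace_integral_span])
  show "h \<in> hecke_int.span (braided_span \<union> C_basis ` {w. d \<in> descents w})"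
    using assms(1) by (simp add: integral_span_def)
  fix g assume "g \<in> braided_span \<union> C_basis ` {w. d \<in> descents w}"
  then consider (braided) "g \<in> braided_span"
    | (rigid) w where "g = C_basis w" "d \<in> descents w" "\<not> braided w"
    using C_basis_braided by blast
  then show "C_simple_mult a g \<in> integral_span a"
  proof cases
    case braided
    then show ?thesis by (intro braided_span_integral C_simple_mult_braided_span)
  next
    case (rigid w)
    then have "a \<notin> descents w" using braided_two_descents assms(2) by blast
    then show ?thesis using rigid(1) C_simple_mult_ascent_integral by simp
  qed
qed

lemma C_simple_mult_integral_quantum:
  assumes "h \<in> integral_span d" shows "C_simple_mult a h \<in> quantum_span a"
proof (cases "a = d")
  case False
  then show ?thesis using integral_quantum_span C_simple_mult_integral assms by blast
next
  case True
  have "C_simple_mult a g \<in> quantum_span a"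
    if "g \<in> braided_span \<union> C_basis ` {w. d \<in> descents w}" for g
    using that True
    by (auto simp: C_simple_mult_descent quantum_two_integral_span C_basis_integral
        integral_quantum_span braided_span_integral C_simple_mult_braided_span)
  then show ?thesis
    using assms hecke_int_span_hom[OF C_simple_mult.module_hom_axioms _ subspace_quantum_span]
    unfolding integral_span_def by blast
qed

lemma C_simple_mult_quantum:
  assumes "h \<in> quantum_span d" "a \<noteq> d" shows "C_simple_mult a h \<in> quantum_span a"
proof -
  have "C_simple_mult a g \<in> quantum_span a"
    if "g \<in> integral_span d \<union> hscale quantum_two ` integral_span d" for g
    using that C_simple_mult_integral[OF _ assms(2)]
    by (auto simp: C_simple_mult.scale integral_quantum_span quantum_two_integral_span)
  then show ?thesis
    using assms(1) hecke_int_span_hom[OF C_simple_mult.module_hom_axioms _ subspace_quantum_span]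
    unfolding quantum_span_def[of d] by blast
qed

lemma C_coeff_integral_span:
  assumes "h \<in> integral_span a" "\<not> braided z"
  shows "\<exists>n. C_coeff h z = of_int n" "a \<notin> descents z \<Longrightarrow> C_coeff h z = 0"
proof -
  let ?G = "braided_span \<union> C_basis ` {w. a \<in> descents w}"
  have h: "h \<in> hecke_int.span ?G" using assms(1) by (simp add: integral_span_def)
  then show "\<exists>n. C_coeff h z = of_int n"
  proof (induction rule: hecke_int.span_induct_alt)
    case (step c g h)
    have "C_coeff g z = of_int 0 \<or> C_coeff g z = of_int 1"
      using step(1) C_coeff_braided_span assms(2) by (auto simp: C_coeff_C_basis when_def)
    then obtain k n where "C_coeff g z = of_int k" "C_coeff h z = of_int n" using step(2) by metis
    then have "C_coeff (hscale (of_int c) g + h) z = of_int (c * k + n)"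
      by (simp add: C_coeff_add C_coeff_scale)
    then show ?case by blast
  qed (auto intro: exI[of _ 0])
  show "C_coeff h z = 0" if "a \<notin> descents z"
    using h
  proof (induction rule: hecke_int.span_induct_alt)
    case (step c g h)
    have "C_coeff g z = 0"
      using step(1) C_coeff_braided_span assms(2) that by (auto simp: C_coeff_C_basis when_def)
    then show ?case using step(2) by (simp add: C_coeff_add C_coeff_scale)
  qed simp
qed

lemma quantum_spanE:
  assumes "h \<in> quantum_span a"
  obtains g k where "h = g + hscale quantum_two k" "g \<in> integral_span a" "k \<in> integral_span a"
proof -
  interpret scale: module_hom "\<lambda>n::int. hscale (of_int n)" "\<lambda>n::int. hscale (of_int n)"
      "hscale quantum_two"
    by (rule module_hom_twist[OF hecke.module_hom_scale_self is_ring_hom_of_int])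
  have "hecke_int.span (integral_span a) = integral_span a"
    by (simp add: integral_span_def hecke_int.span_span)
  moreover from this have "hecke_int.span (hscale quantum_two ` integral_span a) =
      hscale quantum_two ` integral_span a"
    by (simp only: scale.span_image)
  ultimately have "quantum_span a =
      {g + k | g k. g \<in> integral_span a \<and> k \<in> hscale quantum_two ` integral_span a}"
    unfolding quantum_span_def hecke_int.span_Un by (simp only:)
  then show thesis using assms that by auto
qed

lemma C_coeff_quantum_span:
  assumes "h \<in> quantum_span a" "\<not> braided z"
  shows "\<exists>m n. C_coeff h z = of_int m + quantum_two * of_int n" "a \<notin> descents z \<Longrightarrow> C_coeff h z = 0"
proof -
  obtain g k where h: "h = g + hscale quantum_two k"
    and integral: "g \<in> integral_span a" "k \<in> integral_span a"
    using assms(1) by (rule quantum_spanE)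
  obtain m n where "C_coeff g z = of_int m" "C_coeff k z = of_int n"
    using integral C_coeff_integral_span(1) assms(2) by metis
  then show "\<exists>m n. C_coeff h z = of_int m + quantum_two * of_int n"
    unfolding h C_coeff_add C_coeff_scale by metis
  show "C_coeff h z = 0" if "a \<notin> descents z"
    using integral C_coeff_integral_span(2)[OF _ assms(2) that]
    by (simp add: h C_coeff_add C_coeff_scale)
qed

lemma hmult_C_basis_ascent:
  assumes "a \<notin> descents w"
  shows "hmult (C_basis (simple a * w)) h = C_simple_mult a (hmult (C_basis w) h) -
    (\<Sum>z\<in>kl_lower a w. hscale (of_int (mu_coeff z w)) (hmult (C_basis z) h))"
proof -
  have "C_basis (simple a * w) = C_simple_mult a (C_basis w) -
      (\<Sum>z\<in>kl_lower a w. hscale (of_int (mu_coeff z w)) (C_basis z))"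
    using C_simple_mult_ascent[OF assms] by simp
  then show ?thesis
    by (simp add: hmult_left.diff hmult_left.sum hmult_left.scale C_simple_mult_hmult)
qed

lemma hmult_C_basis_rigid_quantum_span:
  "rigid x \<Longrightarrow> a \<in> descents x \<Longrightarrow> h \<in> integral_span d \<Longrightarrow> hmult (C_basis x) h \<in> quantum_span a"
proof (induction "len x" arbitrary: x a rule: less_induct)
  case less
  define y where "y = simple a * x"
  have y: "x = simple a * y" "a \<notin> descents y" "len y < len x"
    using less.prems len_descent[of a x] by (simp_all add: y_def)
  have left: "C_simple_mult a (hmult (C_basis y) h) \<in> quantum_span a"
  proof (cases "y = 1")
    case True
    then show ?thesis using C_simple_mult_integral_quantum less.prems(3) by simp
  next
    case False
    then have rigid_y: "rigid y"
      using not_braided_descent[of x a] less.prems by (simp add: rigid_def y_def)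
    then obtain b where b: "descents y = {b}" by (rule obtain_rigid_descent)
    then have "hmult (C_basis y) h \<in> quantum_span b"
      using less.hyps[OF y(3) rigid_y] less.prems(3) by simp
    moreover have "a \<noteq> b" using b y(2) by auto
    ultimately show ?thesis by (rule C_simple_mult_quantum)
  qed
  have lower: "hmult (C_basis z) h \<in> quantum_span a" if z: "z \<in> kl_lower a y" for z
  proof (cases "braided z")
    case True
    then show ?thesis
      by (intro integral_quantum_span braided_span_integral hmult_braided_span_left C_basis_braided)
  next
    case False
    have a_in_z: "a \<in> descents z" using z by (rule kl_lowerD)
    then have "rigid z" using False by (auto simp: rigid_def)
    then show ?thesis using less.hyps[of z a] len_kl_lower[OF z] y(3) a_in_z less.prems(3) by simp
  qed
  show ?case
    unfolding y(1) hmult_C_basis_ascent[OF y(2)]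
    by (intro hecke_int.subspace_diff hecke_int.subspace_sum hecke_int.subspace_scale
        subspace_quantum_span left lower)
qed

lemma structure_const_not_braided:
  assumes z: "\<not> braided z" and xy: "x \<noteq> 1" "y \<noteq> 1"
  shows "\<exists>m n. structure_const x y z = of_int m + quantum_two * of_int n"
    "z = 1 \<Longrightarrow> structure_const x y z = 0"
proof -
  obtain a where span: "hmult (C_basis x) (C_basis y) \<in> quantum_span a"
  proof (cases "braided x \<or> braided y")
    case True
    then have "hmult (C_basis x) (C_basis y) \<in> braided_span"
      using hmult_braided_span_left hmult_braided_span_right C_basis_braided by blast
    then show thesis by (intro that integral_quantum_span braided_span_integral)
  next
    case False
    then have rigid: "rigid x" using xy by (simp add: rigid_def)
    obtain a where "a \<in> descents x" using xy(1) by (rule descents_nonempty)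
    moreover obtain d where "d \<in> descents y" using xy(2) by (rule descents_nonempty)
    ultimately show thesis
      by (intro that hmult_C_basis_rigid_quantum_span[OF rigid] C_basis_integral)
  qed
  show "\<exists>m n. structure_const x y z = of_int m + quantum_two * of_int n"
    unfolding structure_const_eq_C_coeff by (rule C_coeff_quantum_span(1)[OF span z])
  show "structure_const x y z = 0" if "z = 1"
    unfolding structure_const_eq_C_coeff using that
    by (intro C_coeff_quantum_span(2)[OF span z]) simp
qed

lemma structure_const_one_left: "structure_const 1 y z = (1 when z = y)"
  by (simp add: structure_const_eq_C_coeff C_coeff_C_basis)

lemma structure_const_one_right: "structure_const x 1 z = (1 when z = x)"
  by (simp add: structure_const_eq_C_coeff C_coeff_C_basis)

section \<open>The a-function\<close>

lemma a_fun_le: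
  assumes "\<And>x y k. k < - int i \<Longrightarrow> lookup (structure_const x y z) k = 0"
  shows "a_fun z \<le> enat i"
  unfolding a_fun_def
proof (rule Inf_lower, intro CollectI exI conjI allI ballI)
  fix x y k assume "k \<in> keys (vpow (int i) * structure_const x y z)"
  then have "lookup (structure_const x y z) (k - int i) \<noteq> 0"
    by (simp add: in_keys_iff lookup_vpow_mult)
  then show "0 \<le> k" using assms[of "k - int i" x y] by force
qed simp

lemma a_fun_ge:
  assumes "lookup (structure_const x y z) (- int n) \<noteq> 0"
  shows "enat n \<le> a_fun z"
  unfolding a_fun_def
proof (rule Inf_greatest)
  fix j assume "j \<in> {enat i |i. \<forall>x y. \<forall>k\<in>keys (vpow (int i) * structure_const x y z). 0 \<le> k}"
  then obtain i where i: "j = enat i" "\<And>k. k \<in> keys (vpow (int i) * structure_const x y z) \<Longrightarrow> 0 \<le> k"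
    by blast
  have "int i - int n \<in> keys (vpow (int i) * structure_const x y z)"
    using assms by (simp add: in_keys_iff lookup_vpow_mult)
  from i(2)[OF this] show "enat n \<le> j" using i(1) by simp
qed

lemma a_fun_not_braided:
  assumes "\<not> braided z" shows "a_fun z \<le> 1"
proof -
  have "lookup (structure_const x y z) k = 0" if k: "k < - int 1" for x y k
  proof (cases "x = 1 \<or> y = 1")
    case True
    then show ?thesis
      using k by (auto simp: structure_const_one_left structure_const_one_right lookup_one when_def)
  next
    case False
    then obtain m n where "structure_const x y z = of_int m + quantum_two * of_int n"
      using structure_const_not_braided(1)[OF assms] by blast
    also have "\<dots> = of_int m + (of_int n * vpow 1 + of_int n * vpow (- 1))"
      by (simp add: quantum_two_def distrib_left mult.commute)
    finally show ?thesis
      using k by (simp add: lookup_add lookup_of_int lookup_of_int_mult lookup_vpow when_def)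
  qed
  from a_fun_le[of 1 z, OF this] show ?thesis by (simp add: one_enat_def)
qed

lemma a_fun_one: "a_fun 1 = 0"
proof -
  have "\<not> braided 1" using braided_not_one by blast
  then have "lookup (structure_const x y 1) k = 0" if "k < - int 0" for x y k
    using that structure_const_not_braided(2)[of 1 x y]
    by (cases "x = 1 \<or> y = 1")
      (auto simp: structure_const_one_left structure_const_one_right lookup_one when_def)
  from a_fun_le[of 0 1, OF this] show ?thesis by (simp add: zero_enat_def[symmetric])
qed

lemma C_basis_simple_mult:
  assumes "a \<notin> descents w" "\<And>z. z \<in> kl_lower a w \<Longrightarrow> mu_coeff z w = 0"
  shows "C_basis (simple a * w) = C_simple_mult a (C_basis w)"
  using C_simple_mult_ascent[OF assms(1)] assms(2) by simp

lemma C_basis_simple: "C_basis (simple a) = C_simple_mult a (T_basis 1)"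
  using C_basis_simple_mult[of a 1] len_kl_lower[of _ a 1] by fastforce

lemma C_basis_simple_simple:
  assumes "p \<noteq> q"
  shows "C_basis (simple q * simple p) = C_simple_mult q (C_simple_mult p (T_basis 1))"
proof -
  have "kl_lower q (simple p) = {}"
    using len_kl_lower[of _ q "simple p"] by (fastforce simp: kl_lower_def)
  then show ?thesis using C_basis_simple_mult[of q "simple p"] assms by (simp add: C_basis_simple)
qed

lemma C_basis_coxeter:
  assumes "p \<noteq> q" "a \<noteq> p" "a \<noteq> q"
  shows "C_basis (simple a * (simple q * simple p)) =
    C_simple_mult a (C_simple_mult q (C_simple_mult p (T_basis 1)))"
proof -
  let ?x = "simple q * simple p"
  have len_x: "len ?x = 2" and q: "q \<in> descents ?x"
    using len_ascent[of q "simple p"] assms by simp_all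
  have unique: "b \<notin> descents z" if "len z \<le> 2" "a \<in> descents z" "a \<noteq> b" for z b
    using that len_longest_mult_of_descents[of a z b] by auto
  have "a \<notin> descents ?x" using unique[of ?x q] len_x q assms by auto
  moreover have "mu_coeff z ?x = 0" if z: "z \<in> kl_lower a ?x" for z
  proof (rule mu_coeff_eq_0_if_descent[OF q])
    have a_in_z: "a \<in> descents z" using z by (rule kl_lowerD)
    then show "q \<notin> descents z" using unique[of z q] len_kl_lower[OF z] len_x assms by simp
    show "simple q * z \<noteq> ?x" using a_in_z assms by (auto simp: weyl_group.left_cancel)
  qed
  ultimately show ?thesis using C_basis_simple_mult C_basis_simple_simple[OF assms(1)] by simp
qed

lemma ex_hmult_eq_quantum_two_square:
  assumes u: "braided u"
  shows "\<exists>x y. hmult (C_basis x) (C_basis y) = hscale (quantum_two * quantum_two) (C_basis u)"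
proof -
  obtain a where a: "a \<in> descents u" using braided_not_one[OF u] by (rule descents_nonempty)
  show ?thesis
  proof (cases "descents u = {a}")
    case False
    then obtain p where p: "p \<in> descents u" "p \<noteq> a" using a by blast
    have "hmult (C_basis (simple a * simple p)) (C_basis u) =
        hscale (quantum_two * quantum_two) (C_basis u)"
      unfolding C_basis_simple_simple[OF p(2)] C_simple_mult_hmult[symmetric]
      by (simp add: C_simple_mult_descent p a C_simple_mult.scale)
    then show ?thesis by blast
  next
    case True
    define m where "m = simple a * u"
    have m: "descents m = - {a}" using descents_of_unique_descent[OF u True] by (simp add: m_def)
    obtain p q where pq: "p \<noteq> a" "q \<noteq> a" "p \<noteq> q" by (rule obtain_other_gens)
    have "C_basis u = C_simple_mult a (C_basis m)"
      using C_simple_mult_two_descents[of p m q a] m pq a by (simp add: m_def)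
    then have "hmult (C_basis (simple a * (simple q * simple p))) (C_basis m) =
        hscale (quantum_two * quantum_two) (C_basis u)"
      unfolding C_basis_coxeter[OF pq(3) pq(1,2)[symmetric]] C_simple_mult_hmult[symmetric]
      using m pq by (simp add: C_simple_mult_descent C_simple_mult.scale)
    then show ?thesis by blast
  qed
qed

lemma a_fun_braided:
  assumes "braided u" shows "2 \<le> a_fun u"
proof -
  obtain x y where "hmult (C_basis x) (C_basis y) = hscale (quantum_two * quantum_two) (C_basis u)"
    using ex_hmult_eq_quantum_two_square[OF assms] by blast
  then have "structure_const x y u = quantum_two * quantum_two"
    by (simp add: structure_const_eq_C_coeff C_coeff_scale C_coeff_C_basis)
  also have "\<dots> = vpow 2 + 2 + vpow (- 2)"
    by (simp add: quantum_two_def distrib_left distrib_right vpow_mult)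
  finally have "lookup (structure_const x y u) (- int 2) = 1"
    by (simp add: lookup_add lookup_vpow when_def lookup_numeral)
  then show ?thesis using a_fun_ge[of x y u 2] by (simp add: numeral_eq_enat)
qed

theorem theorem4p8:
  fixes u w :: weyl
  assumes "bruhat_less u w" and "u \<in> c1" and "w \<in> c0"
  shows "(len w - len u = 1 \<longrightarrow> mu u w = 1) \<and> (len w - len u \<noteq> 1 \<longrightarrow> mu u w = 0)"
proof -
  have below: "bruhat_le u w" and len: "len u < len w"
    using assms(1) bruhat_less_len by (auto simp: bruhat_less_def)
  have a_fun: "a_fun u = 1" "a_fun w = 3" using assms by (simp_all add: c1_def c0_def)
  have "u \<noteq> 1" using a_fun a_fun_one by auto
  moreover have "\<not> braided u"
    using a_fun a_fun_braided[of u] by (auto simp: one_enat_def numeral_eq_enat)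
  moreover have "braided w"
    using a_fun a_fun_not_braided[of w] by (auto simp: one_enat_def numeral_eq_enat)
  ultimately show ?thesis
    using mu_coeff_rigid_braided[of u w] mu_coeff_len_1[OF below] len
    by (auto simp: mu_eq_mu_coeff rigid_def)
qed

end
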